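(* Let $(S_n)$ be the elephant random walk with memory parameter $p\in[0,1]$ and first-step parameter $q\in[0,1]$, and let $V_n=4\sum_{k=1}^{n-1}(S_k/k)^2$. Under the null hypothesis $\mathcal{H}_0$: $p=3/4$, $$\frac{1}{(\log n)^2}V_n\longrightarrow4\Lambda\quad\text{in distribution as }n\to\infty,$$ where $\Lambda=\int_0^1B_t^2\,\mathrm{d}t$ is the integral of the squared standard Brownian motion $(B_t)$. Moreover, under the alternative hypothesis $\mathcal{H}_1$: $p<3/4$, $$\lim_{n\to\infty}\frac{1}{(\log n)^2}V_n=0\qquad\text{almost surely}.$$
   Context: Elephant random walk (ERW): fix $q\in[0,1]$ and $p\in[0,1]$. Set $S_0=0$. The first step $X_1$ equals $+1$ with probability $q$ and $-1$ with probability $1-q$. For each $n\ge 1$, an integer $k$ is chosen uniformly at random among $1,\dots,n$ (independently of the past), and $X_{n+1}=X_k$ with probability $p$, $X_{n+1}=-X_k$ with probability $1-p$. The position is $S_{n+1}=S_n+X_{n+1}$, so $S_n=X_1+\cdots+X_n$. Equivalently, with $\mathcal{F}_n=\sigma(X_1,\dots,X_n)$, $\mathbb{P}(X_{n+1}=1\mid\mathcal{F}_n)=\frac12\bigl(1+(2p-1)\frac{S_n}{n}\bigr)$ and $\mathbb{P}(X_{n+1}=-1\mid\mathcal{F}_n)=\frac12\bigl(1-(2p-1)\frac{S_n}{n}\bigr)$ for all $n\ge1$. *)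

theory Defs
  imports "HOL-Probability.Probability"
begin

text \<open>The elephant random walk. For n \<open>\<ge>\<close> 1, \<open>K n\<close> is the remembered time and \<open>R n\<close> says
  whether the remembered step is repeated (true) or reversed (false); together they produce
  step n + 1. The past at time n is generated by the steps \<open>X 1, ..., X n\<close>; the value
  \<open>X 0\<close> plays no role.\<close>

locale elephant_random_walk = prob_space M
  for M :: "'a measure" +
  fixes p q :: real
    and X :: "nat \<Rightarrow> 'a \<Rightarrow> real"
    and K :: "nat \<Rightarrow> 'a \<Rightarrow> nat"
    and R :: "nat \<Rightarrow> 'a \<Rightarrow> bool"
  assumes p_range: "0 \<le> p" "p \<le> 1"
    and q_range: "0 \<le> q" "q \<le> 1"
    and first_step_measurable: "random_variable borel (X 1)"
    and first_step: "prob {\<omega> \<in> space M. X 1 \<omega> = 1} = q"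
      "prob {\<omega> \<in> space M. X 1 \<omega> = -1} = 1 - q"
    and choice_distr: "n \<ge> 1 \<Longrightarrow>
      distr M (count_space UNIV) (\<lambda>\<omega>. (K n \<omega>, R n \<omega>)) =
        measure_pmf (pair_pmf (pmf_of_set {1..n}) (bernoulli_pmf p))"
    and choice_indep: "n \<ge> 1 \<Longrightarrow>
      indep_set
        (sigma_sets (space M) (\<Union>i\<in>{1..n}. {X i -` C \<inter> space M | C. C \<in> sets borel}))
        (sets (vimage_algebra (space M) (\<lambda>\<omega>. (K n \<omega>, R n \<omega>)) (count_space UNIV)))"
    and next_step: "n \<ge> 1 \<Longrightarrow> \<omega> \<in> space M \<Longrightarrow>
      X (Suc n) \<omega> = (if R n \<omega> then X (K n \<omega>) \<omega> else - X (K n \<omega>) \<omega>)"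

definition erw_position :: "(nat \<Rightarrow> 'a \<Rightarrow> real) \<Rightarrow> nat \<Rightarrow> 'a \<Rightarrow> real" where
  "erw_position X n \<omega> = (\<Sum>k=1..n. X k \<omega>)"

definition erw_V :: "(nat \<Rightarrow> 'a \<Rightarrow> real) \<Rightarrow> nat \<Rightarrow> 'a \<Rightarrow> real" where
  "erw_V X n \<omega> = 4 * (\<Sum>k=1..<n. (erw_position X k \<omega> / real k)\<^sup>2)"

text \<open>Only \<open>B t\<close> with t \<open>\<ge>\<close> 0 matters. Continuity is required of every path, not just almost
  every path, so that path functionals such as the integral below are measurable even
  when the underlying probability space is not complete.\<close>

locale standard_brownian_motion = prob_space N
  for N :: "'b measure" +
  fixes B :: "real \<Rightarrow> 'b \<Rightarrow> real"
  assumes measurable_B: "t \<ge> 0 \<Longrightarrow> random_variable borel (B t)"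
    and starts_at_0: "AE \<omega> in N. B 0 \<omega> = 0"
    and indep_increments: "mono \<tau> \<Longrightarrow> 0 \<le> \<tau> 0 \<Longrightarrow>
      indep_vars (\<lambda>_. borel) (\<lambda>i \<omega>. B (\<tau> (Suc i)) \<omega> - B (\<tau> i) \<omega>) {..<m :: nat}"
    and normal_increments: "0 \<le> s \<Longrightarrow> s < u \<Longrightarrow>
      distributed N lborel (\<lambda>\<omega>. B u \<omega> - B s \<omega>) (normal_density 0 (sqrt (u - s)))"
    and continuous_paths: "\<omega> \<in> space N \<Longrightarrow> continuous_on {0..} (\<lambda>t. B t \<omega>)"

definition integral_of_square :: "(real \<Rightarrow> 'b \<Rightarrow> real) \<Rightarrow> 'b \<Rightarrow> real" where
  "integral_of_square B \<omega> = (LBINT t:{0..1}. (B t \<omega>)\<^sup>2)"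

end

theory Submission
  imports Defs
begin

text \<open>At p = 3/4 the normalized walk S(k) / sqrt(k log n) behaves, in the time scale
  log k / log n, like a Brownian motion, and V(n) / (log n)^2 is a Riemann sum of 4 times its square.
  Instead of a functional limit theorem we compare Laplace transforms, which determine weak
  convergence of nonnegative variables. By Cameron and Martin the transform of the integral of B^2
  is 1 / sqrt(cosh z), with an explicit exponential martingale. The same function of the walk is a
  martingale up to errors whose sum is O(1 / log n), because S(k)^4 has expectation O(k^3). Evaluating the
  martingale at both ends gives the same limit 1 / sqrt(cosh z) for the walk and for Gaussian random
  walks approximating B.

  For p < 3/4 the second moment of S(k) is O(k), so V(n) has expectation O(log n); this is summable
  against (log n)^2 along n = 2^(2^j), and V is monotone.\<close>

section \<open>The Cameron-Martin exponent\<close>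

text \<open>At p = 3/4 the conditional mean of step k + 1 is S(k) / (2k). This is the relative
  growth of sqrt k, so S(k) / sqrt k has no drift to leading order and gains variance about 1 / k;
  the clock is therefore the harmonic number divided by L = log n. The walk and the Brownian motion
  live on unrelated spaces and are never coupled: each transform is computed separately and the two
  values agree.

  The obstacle is the accumulated error. With \<sigma> = S(k) / k, replacing a step of size 1 by a
  Gaussian one costs a multiple of \<sigma>^4 / L^2. The bound |\<sigma>| \<le> 1 alone would give n
  / L^2 in total. The second moment does not suffice either: at p = 3/4 it equals k *
  \<open>harm k\<close>, so the sum of E \<sigma>^2 is of order L^2 and the total would not vanish.
  The fourth moment gives E \<sigma>^4 \<le> 9 / k, hence a total of order \<open>harm n\<close> /
  L^2, that is 1 / L. The remaining errors are of order 1 / (k L^2), or telescope to 1 / L.\<close>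

text \<open>For a Brownian motion B the expectation of exp(-(z^2/2) * integral of (x + B)^2 over [0,r]) is
  exp(log_weight z r - riccati z r * x^2 / 2): the exponent solves the Riccati system
  a' = z^2 - a^2, l' = -a/2.\<close>

definition riccati :: "real \<Rightarrow> real \<Rightarrow> real" where
  "riccati z r = z * tanh (z * r)"

definition log_weight :: "real \<Rightarrow> real \<Rightarrow> real" where
  "log_weight z r = - ln (cosh (z * r)) / 2"

lemma riccati_0 [simp]: "riccati z 0 = 0"
  by (simp add: riccati_def)

lemma log_weight_0 [simp]: "log_weight z 0 = 0"
  by (simp add: log_weight_def)

lemma log_weight_nonpos: "log_weight z r \<le> 0"
  by (simp add: log_weight_def cosh_real_ge_1)

text \<open>At \<open>r = 1\<close> this is the common limit of both transforms.\<close>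

lemma exp_log_weight: "exp (log_weight z r) = 1 / sqrt (cosh (z * r))"
proof -
  have "exp (log_weight z r) = inverse (exp (ln (cosh (z * r)) / 2))"
    by (simp add: log_weight_def exp_minus)
  also have "exp (ln (cosh (z * r)) / 2) = sqrt (cosh (z * r))"
    by (simp add: ln_sqrt[symmetric])
  finally show ?thesis by (simp add: inverse_eq_divide)
qed

lemma riccati_bounds:
  assumes "0 \<le> z" "0 \<le> r"
  shows "0 \<le> riccati z r" "riccati z r \<le> z"
  using assms tanh_real_lt_1[of "z * r"]
  by (auto simp: riccati_def intro!: mult_left_le)

lemma riccati_sq_le:
  assumes "0 \<le> z" "0 \<le> r"
  shows "(riccati z r)\<^sup>2 \<le> z\<^sup>2"
  using riccati_bounds[OF assms] by (simp add: power_mono)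

lemma has_derivative_riccati:
  "(riccati z has_real_derivative z\<^sup>2 - (riccati z r)\<^sup>2) (at r)"
  unfolding riccati_def[abs_def]
  by (auto intro!: derivative_eq_intros simp: power2_eq_square algebra_simps)

lemma has_derivative_log_weight:
  "(log_weight z has_real_derivative - riccati z r / 2) (at r)"
  unfolding log_weight_def[abs_def] riccati_def
  by (auto intro!: derivative_eq_intros simp: tanh_def)

lemma MVT_shift:
  fixes f f' :: "real \<Rightarrow> real"
  assumes "0 \<le> h" "\<And>x. (f has_real_derivative f' x) (at x)"
  obtains \<xi> where "r \<le> \<xi>" "\<xi> \<le> r + h" "f (r + h) - f r = h * f' \<xi>"
proof (cases "h = 0")
  case True
  then show ?thesis using that[of r] by simp
next
  case False
  then show ?thesis
    using MVT2[of r "r + h" f f'] assms that by (auto dest: less_imp_le)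
qed

lemma riccati_diff:
  assumes "0 \<le> z" "0 \<le> r" "0 \<le> h"
  shows "\<bar>riccati z (r + h) - riccati z r\<bar> \<le> z\<^sup>2 * h"
proof -
  obtain \<xi> where \<xi>: "r \<le> \<xi>" "riccati z (r + h) - riccati z r = h * (z\<^sup>2 - (riccati z \<xi>)\<^sup>2)"
    using MVT_shift[OF assms(3) has_derivative_riccati] by metis
  have "0 \<le> z\<^sup>2 - (riccati z \<xi>)\<^sup>2" "z\<^sup>2 - (riccati z \<xi>)\<^sup>2 \<le> z\<^sup>2"
    using riccati_sq_le[of z \<xi>] assms \<xi> by auto
  then show ?thesis
    using \<xi>(2) assms(3) by (simp add: abs_mult mult_left_mono mult.commute)
qed

text \<open>The mean value theorem gives the slope at an intermediate point \<xi>. The slopes at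
  \<xi> and \<open>r\<close> differ by a difference of two squares, whose factors are at most z^2 h
  (Lipschitz bound) and 2 z.\<close>

lemma riccati_taylor:
  assumes "0 \<le> z" "0 \<le> r" "0 \<le> h"
  shows "\<bar>riccati z (r + h) - riccati z r - h * (z\<^sup>2 - (riccati z r)\<^sup>2)\<bar> \<le> 2 * z ^ 3 * h\<^sup>2"
proof -
  obtain \<xi> where \<xi>: "r \<le> \<xi>" "\<xi> \<le> r + h"
      "riccati z (r + h) - riccati z r = h * (z\<^sup>2 - (riccati z \<xi>)\<^sup>2)"
    using MVT_shift[OF assms(3) has_derivative_riccati] by metis
  have d: "\<bar>riccati z \<xi> - riccati z r\<bar> \<le> z\<^sup>2 * h"
    using riccati_diff[OF assms(1,2), of "\<xi> - r"] mult_left_mono[of "\<xi> - r" h "z\<^sup>2"] \<xi> assms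
    by auto
  have s: "\<bar>riccati z \<xi> + riccati z r\<bar> \<le> 2 * z"
    using riccati_bounds[of z \<xi>] riccati_bounds[of z r] assms \<xi> by auto
  have "riccati z (r + h) - riccati z r - h * (z\<^sup>2 - (riccati z r)\<^sup>2)
      = - h * ((riccati z \<xi> - riccati z r) * (riccati z \<xi> + riccati z r))"
    unfolding \<xi>(3) by (simp add: algebra_simps power2_eq_square)
  then have "\<bar>riccati z (r + h) - riccati z r - h * (z\<^sup>2 - (riccati z r)\<^sup>2)\<bar>
      = h * (\<bar>riccati z \<xi> - riccati z r\<bar> * \<bar>riccati z \<xi> + riccati z r\<bar>)"
    using assms(3) by (simp add: abs_mult)
  also have "\<dots> \<le> h * ((z\<^sup>2 * h) * (2 * z))"
    using d s assms by (intro mult_left_mono mult_mono) auto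
  finally show ?thesis by (simp add: power2_eq_square power3_eq_cube algebra_simps)
qed

lemma log_weight_taylor:
  assumes "0 \<le> z" "0 \<le> r" "0 \<le> h"
  shows "\<bar>log_weight z (r + h) - log_weight z r + h * riccati z r / 2\<bar> \<le> z\<^sup>2 * h\<^sup>2 / 2"
proof -
  obtain \<xi> where \<xi>: "r \<le> \<xi>" "\<xi> \<le> r + h"
      "log_weight z (r + h) - log_weight z r = h * (- riccati z \<xi> / 2)"
    using MVT_shift[OF assms(3) has_derivative_log_weight] by metis
  have d: "\<bar>riccati z \<xi> - riccati z r\<bar> \<le> z\<^sup>2 * h"
    using riccati_diff[OF assms(1,2), of "\<xi> - r"] mult_left_mono[of "\<xi> - r" h "z\<^sup>2"] \<xi> assms
    by auto
  have "log_weight z (r + h) - log_weight z r + h * riccati z r / 2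
      = - (h / 2) * (riccati z \<xi> - riccati z r)"
    unfolding \<xi>(3) by (simp add: algebra_simps)
  then have "\<bar>log_weight z (r + h) - log_weight z r + h * riccati z r / 2\<bar>
      = h / 2 * \<bar>riccati z \<xi> - riccati z r\<bar>"
    using assms(3) by (simp add: abs_mult)
  also have "\<dots> \<le> h / 2 * (z\<^sup>2 * h)"
    using d assms by (intro mult_left_mono) auto
  finally show ?thesis by (simp add: power2_eq_square algebra_simps)
qed

section \<open>Elementary estimates for exp, cosh and sinh\<close>

text \<open>On the nonpositive half-line exp is 1-Lipschitz. This reduces the comparison of weights
  to that of exponents, and it is why the signs of all exponents are tracked below.\<close>

lemma abs_exp_diff_le:
  fixes x y :: real
  assumes "x \<le> 0" "y \<le> 0"
  shows "\<bar>exp x - exp y\<bar> \<le> \<bar>x - y\<bar>"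
proof -
  have *: "exp b - exp a \<le> b - a" if "a \<le> b" "b \<le> 0" for a b :: real
  proof -
    have "exp b - exp a = exp b * (1 - exp (a - b))"
      by (simp add: exp_diff field_simps)
    also have "\<dots> \<le> 1 * (b - a)"
    proof (rule mult_mono)
      show "1 - exp (a - b) \<le> b - a" using exp_ge_add_one_self[of "a - b"] by linarith
    qed (use that in auto)
    finally show ?thesis by simp
  qed
  then show ?thesis
    using assms *[of x y] *[of y x] by (cases "x \<le> y") auto
qed

text \<open>Odd terms of the two exponential expansions cancel, and each remainder carries a factor
  of at most e < 3.\<close>

lemma abs_cosh_taylor:
  fixes b :: real
  assumes "\<bar>b\<bar> \<le> 1"
  shows "\<bar>cosh b - 1 - b\<^sup>2 / 2\<bar> \<le> b ^ 4"
proof -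
  obtain t where t: "exp b = (\<Sum>m<4. b ^ m / fact m) + exp t / fact 4 * b ^ 4" "\<bar>t\<bar> \<le> \<bar>b\<bar>"
    using Maclaurin_exp_le[of b 4] by blast
  obtain u where u: "exp (-b) = (\<Sum>m<4. (-b) ^ m / fact m) + exp u / fact 4 * (-b) ^ 4" "\<bar>u\<bar> \<le> \<bar>-b\<bar>"
    using Maclaurin_exp_le[of "-b" 4] by blast
  have e: "exp t \<le> 3" "exp u \<le> 3"
    using t(2) u(2) assms by (auto intro!: order_trans[OF _ exp_le])
  have "cosh b - 1 - b\<^sup>2 / 2 = (exp t + exp u) / 48 * b ^ 4"
    unfolding cosh_field_def t(1) u(1)
    by (simp add: eval_nat_numeral field_simps)
  also have "\<bar>\<dots>\<bar> \<le> 1 * b ^ 4"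
    using e by (subst abs_mult) (intro mult_mono, auto)
  finally show ?thesis by simp
qed

lemma abs_sinh_taylor:
  fixes b :: real
  assumes "\<bar>b\<bar> \<le> 1"
  shows "\<bar>sinh b - b\<bar> \<le> \<bar>b\<bar> ^ 3"
proof -
  obtain t where t: "exp b = (\<Sum>m<3. b ^ m / fact m) + exp t / fact 3 * b ^ 3" "\<bar>t\<bar> \<le> \<bar>b\<bar>"
    using Maclaurin_exp_le[of b 3] by blast
  obtain u where u: "exp (-b) = (\<Sum>m<3. (-b) ^ m / fact m) + exp u / fact 3 * (-b) ^ 3" "\<bar>u\<bar> \<le> \<bar>-b\<bar>"
    using Maclaurin_exp_le[of "-b" 3] by blast
  have e: "exp t \<le> 3" "exp u \<le> 3"
    using t(2) u(2) assms by (auto intro!: order_trans[OF _ exp_le])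
  have "sinh b - b = (exp t + exp u) / 12 * b ^ 3"
    unfolding sinh_field_def t(1) u(1)
    by (simp add: eval_nat_numeral field_simps)
  also have "\<bar>\<dots>\<bar> \<le> 1 * \<bar>b\<bar> ^ 3"
    using e by (subst abs_mult) (intro mult_mono, auto simp: power_abs)
  finally show ?thesis by simp
qed

lemma abs_exp_taylor1:
  fixes w :: real
  assumes "\<bar>w\<bar> \<le> 1"
  shows "\<bar>exp w - 1 - w\<bar> \<le> 2 * w\<^sup>2"
proof -
  obtain t where t: "exp w = (\<Sum>m<2. w ^ m / fact m) + exp t / fact 2 * w ^ 2" "\<bar>t\<bar> \<le> \<bar>w\<bar>"
    using Maclaurin_exp_le[of w 2] by blast
  have e: "exp t \<le> 3"
    using t(2) assms by (auto intro!: order_trans[OF _ exp_le])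
  have "exp w - 1 - w = exp t / 2 * w\<^sup>2"
    unfolding t(1) by (simp add: eval_nat_numeral)
  also have "\<bar>\<dots>\<bar> \<le> 2 * w\<^sup>2"
    using e by (subst abs_mult) (intro mult_mono, auto)
  finally show ?thesis by simp
qed

text \<open>For a step x with values 1 and -1 and mean s, the expectation of exp(- b x) is cosh b -
  s sinh b. The lemma replaces it by exp(b^2 / 2 - s b), the value for a normal step with mean s and
  variance 1. The walk uses s = \<sigma> / 2 up to sign and C = z / L, so that C^2 supplies the
  decisive factor 1 / L^2.\<close>

lemma cosh_sinh_exp_approx:
  fixes b s \<sigma> C :: real
  assumes b: "\<bar>b\<bar> \<le> C * \<sigma>" and s: "\<bar>s\<bar> \<le> \<sigma> / 2" and C: "0 \<le> C" "C \<le> 1" and \<sigma>: "0 \<le> \<sigma>" "\<sigma> \<le> 1"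
  shows "\<bar>cosh b - s * sinh b - exp (b\<^sup>2 / 2 - s * b)\<bar> \<le> 7 * C\<^sup>2 * \<sigma> ^ 4"
proof -
  define w where "w = b\<^sup>2 / 2 - s * b"
  have C\<sigma>: "C * \<sigma> \<le> \<sigma>" "C * \<sigma> \<le> 1" "0 \<le> C * \<sigma>"
    using C \<sigma> by (auto intro: mult_le_one simp: mult_left_le_one_le)
  have b1: "\<bar>b\<bar> \<le> \<sigma>" "\<bar>b\<bar> \<le> 1" using b C\<sigma> by auto
  have b2: "\<bar>b\<bar>\<^sup>2 \<le> (C * \<sigma>)\<^sup>2" using b by (intro power_mono) auto
  have bb: "b ^ 4 \<le> C\<^sup>2 * \<sigma> ^ 4"
  proof -
    have "b ^ 4 = \<bar>b\<bar>\<^sup>2 * \<bar>b\<bar>\<^sup>2" by (simp add: power_mult_distrib eval_nat_numeral)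
    also have "\<dots> \<le> (C * \<sigma>)\<^sup>2 * \<sigma>\<^sup>2"
      using b2 b1 by (intro mult_mono[OF b2] power_mono) auto
    finally show ?thesis by (simp add: power_mult_distrib eval_nat_numeral algebra_simps)
  qed
  have sb: "\<bar>s\<bar> * \<bar>b\<bar> ^ 3 \<le> C\<^sup>2 * \<sigma> ^ 4"
  proof -
    have "\<bar>s\<bar> * \<bar>b\<bar> ^ 3 = \<bar>b\<bar>\<^sup>2 * (\<bar>s\<bar> * \<bar>b\<bar>)" by (simp add: eval_nat_numeral)
    also have "\<dots> \<le> (C * \<sigma>)\<^sup>2 * (\<sigma> * \<sigma>)"
      using b2 b1 s \<sigma> by (intro mult_mono) auto
    finally show ?thesis by (simp add: power_mult_distrib eval_nat_numeral algebra_simps)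
  qed
  have sb2: "(s * b)\<^sup>2 \<le> C\<^sup>2 * \<sigma> ^ 4"
  proof -
    have "(s * b)\<^sup>2 = \<bar>s\<bar>\<^sup>2 * \<bar>b\<bar>\<^sup>2" by (simp add: power_mult_distrib)
    also have "\<dots> \<le> \<sigma>\<^sup>2 * (C * \<sigma>)\<^sup>2"
      using b2 s \<sigma> by (intro mult_mono[OF _ b2] power_mono) auto
    finally show ?thesis by (simp add: power_mult_distrib eval_nat_numeral algebra_simps)
  qed
  have w2: "w\<^sup>2 \<le> b ^ 4 / 2 + 2 * (s * b)\<^sup>2"
  proof -
    have "0 \<le> (b\<^sup>2 / 2 + s * b)\<^sup>2" by simp
    then show ?thesis unfolding w_def by (simp add: power2_eq_square eval_nat_numeral field_simps)
  qed
  have w1: "\<bar>w\<bar> \<le> 1"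
  proof -
    have "b\<^sup>2 / 2 \<le> 1 / 2" using b1 by (simp add: abs_square_le_1)
    moreover have "\<bar>s * b\<bar> \<le> 1 / 2 * 1"
      unfolding abs_mult using b1 s \<sigma> by (intro mult_mono) auto
    moreover have "0 \<le> b\<^sup>2 / 2" by simp
    ultimately show ?thesis unfolding w_def by linarith
  qed
  have "\<bar>cosh b - s * sinh b - exp w\<bar>
      = \<bar>(cosh b - 1 - b\<^sup>2 / 2) - s * (sinh b - b) - (exp w - 1 - w)\<bar>"
    by (simp add: w_def algebra_simps)
  also have "\<dots> \<le> \<bar>cosh b - 1 - b\<^sup>2 / 2\<bar> + \<bar>s\<bar> * \<bar>sinh b - b\<bar> + \<bar>exp w - 1 - w\<bar>"
    unfolding abs_mult[symmetric] by linarith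
  also have "\<dots> \<le> b ^ 4 + \<bar>s\<bar> * \<bar>b\<bar> ^ 3 + 2 * w\<^sup>2"
    using abs_cosh_taylor[OF b1(2)] abs_sinh_taylor[OF b1(2)] abs_exp_taylor1[OF w1]
    by (intro add_mono mult_left_mono) auto
  \<comment> \<open>In units of C^2 \<sigma>^4 the three terms cost 1, 1 and 2 * (1/2 + 2) =
    5.\<close>
  also have "\<dots> \<le> 7 * (C\<^sup>2 * \<sigma> ^ 4)"
    using bb sb sb2 w2 by linarith
  finally show ?thesis by (simp add: w_def)
qed

section \<open>Laplace transforms and weak convergence\<close>

text \<open>Polynomials in exp(-Y) are linear combinations of the transforms below, and by Weierstrass
  they approximate every continuous step function of Y uniformly.\<close>

lemma weak_conv_m_if_Laplace_transforms:
  fixes Y :: "nat \<Rightarrow> 'a \<Rightarrow> real" and Z :: "'b \<Rightarrow> real"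
  assumes M: "prob_space M" and N: "prob_space N"
    and Y[measurable]: "\<And>n. Y n \<in> borel_measurable M" and Z[measurable]: "Z \<in> borel_measurable N"
    and Y0: "\<And>n \<omega>. \<omega> \<in> space M \<Longrightarrow> 0 \<le> Y n \<omega>" and Z0: "\<And>\<omega>. \<omega> \<in> space N \<Longrightarrow> 0 \<le> Z \<omega>"
    and lim: "\<And>m::nat. (\<lambda>n. \<integral>\<omega>. exp (- (real m * Y n \<omega>)) \<partial>M) \<longlonglongrightarrow> (\<integral>\<omega>. exp (- (real m * Z \<omega>)) \<partial>N)"
  shows "weak_conv_m (\<lambda>n. distr M borel (Y n)) (distr N borel Z)"
proof (rule integral_cts_step_conv_imp_weak_conv)
  interpret M: prob_space M by fact
  interpret N: prob_space N by fact
  show "real_distribution (distr M borel (Y n))" for n by (simp add: M.real_distribution_distr)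
  show "real_distribution (distr N borel Z)" by (simp add: N.real_distribution_distr)
  fix x y :: real assume xy: "x < y"
  \<comment> \<open>The step function in the variable u = exp(- s). Clamping u at exp(- y) keeps the
    logarithm continuous down to u = 0 and changes nothing, since the step function already vanishes
    for s \<ge> y.\<close>
  define g where "g u = cts_step x y (- ln (max u (exp (- y))))" for u
  have cont: "continuous_on UNIV (cts_step x y)"
    using cts_step_uniformly_continuous[OF xy] by (rule uniformly_continuous_imp_continuous)
  have pos: "max u (exp (- y)) > 0" for u by (simp add: less_max_iff_disj)
  have "continuous_on {0..1} (\<lambda>u. - ln (max u (exp (- y))))"
    using pos by (intro continuous_intros) (auto simp: less_imp_neq[symmetric])
  then have g_cont: "continuous_on {0..1} g"
    unfolding g_def by (rule continuous_on_compose2[OF cont]) auto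
  have g_eq: "cts_step x y s = g (exp (- s))" for s
  proof (cases "s \<le> y")
    case True
    then have "max (exp (- s)) (exp (- y)) = exp (- s)" by (simp add: max_def)
    then show ?thesis by (simp add: g_def)
  next
    case False
    then have "max (exp (- s)) (exp (- y)) = exp (- y)" by (simp add: max_def)
    then show ?thesis using False xy by (simp add: g_def cts_step_def)
  qed
  have [measurable]: "cts_step x y \<in> borel_measurable borel"
    using cont by (rule borel_measurable_continuous_onI)
  have cts_bd: "\<bar>cts_step x y s\<bar> \<le> 1" for s
    using xy by (auto simp: cts_step_def field_simps)
  have intM: "integrable M (\<lambda>\<omega>. cts_step x y (Y n \<omega>))" for n
    by (rule M.integrable_const_bound[of _ 1]) (auto simp: cts_bd)
  have intN: "integrable N (\<lambda>\<omega>. cts_step x y (Z \<omega>))"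
    by (rule N.integrable_const_bound[of _ 1]) (auto simp: cts_bd)
  have "(\<lambda>n. \<integral>\<omega>. cts_step x y (Y n \<omega>) \<partial>M) \<longlonglongrightarrow> (\<integral>\<omega>. cts_step x y (Z \<omega>) \<partial>N)"
  proof (rule LIMSEQ_I)
    fix e :: real assume e: "0 < e"
    obtain h where h: "real_polynomial_function h" "\<And>u. u \<in> {0..1} \<Longrightarrow> \<bar>g u - h u\<bar> < e / 4"
      using Stone_Weierstrass_real_polynomial_function[OF compact_Icc g_cont, of "e / 4"] e by auto
    obtain a d where hd: "h = (\<lambda>u. \<Sum>i\<le>d. a i * u ^ i)"
      using h(1) unfolding real_polynomial_function_iff_sum by auto
    have pow: "exp (- s) ^ i = exp (- (real i * s))" for s i
      by (simp add: exp_of_nat_mult[symmetric])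
    have iM: "integrable M (\<lambda>\<omega>. exp (- (real i * Y n \<omega>)))" for i n
      using Y0 by (intro M.integrable_const_bound[of _ 1]) auto
    have iN: "integrable N (\<lambda>\<omega>. exp (- (real i * Z \<omega>)))" for i
      using Z0 by (intro N.integrable_const_bound[of _ 1]) auto
    have hM: "integrable M (\<lambda>\<omega>. h (exp (- Y n \<omega>)))"
      "(\<integral>\<omega>. h (exp (- Y n \<omega>)) \<partial>M) = (\<Sum>i\<le>d. a i * (\<integral>\<omega>. exp (- (real i * Y n \<omega>)) \<partial>M))" for n
      unfolding hd pow using iM by (auto intro!: Bochner_Integration.integrable_sum)
    have hN: "integrable N (\<lambda>\<omega>. h (exp (- Z \<omega>)))"
      "(\<integral>\<omega>. h (exp (- Z \<omega>)) \<partial>N) = (\<Sum>i\<le>d. a i * (\<integral>\<omega>. exp (- (real i * Z \<omega>)) \<partial>N))"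
      unfolding hd pow using iN by (auto intro!: Bochner_Integration.integrable_sum)
    have "(\<lambda>n. \<integral>\<omega>. h (exp (- Y n \<omega>)) \<partial>M) \<longlonglongrightarrow> (\<integral>\<omega>. h (exp (- Z \<omega>)) \<partial>N)"
      unfolding hM hN by (intro tendsto_intros lim)
    then obtain n0 where n0: "\<And>n. n \<ge> n0 \<Longrightarrow>
        \<bar>(\<integral>\<omega>. h (exp (- Y n \<omega>)) \<partial>M) - (\<integral>\<omega>. h (exp (- Z \<omega>)) \<partial>N)\<bar> < e / 4"
      using LIMSEQ_D[of _ _ "e / 4"] e by (metis divide_pos_pos real_norm_def zero_less_numeral)
    have close: "\<bar>g (exp (- s)) - h (exp (- s))\<bar> \<le> e / 4" if "0 \<le> s" for s
      using h(2)[of "exp (- s)"] that by auto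
    have A: "\<bar>(\<integral>\<omega>. cts_step x y (Y n \<omega>) \<partial>M) - (\<integral>\<omega>. h (exp (- Y n \<omega>)) \<partial>M)\<bar> \<le> e / 4" for n
    proof -
      have "\<bar>\<integral>\<omega>. cts_step x y (Y n \<omega>) - h (exp (- Y n \<omega>)) \<partial>M\<bar>
          \<le> (\<integral>\<omega>. \<bar>cts_step x y (Y n \<omega>) - h (exp (- Y n \<omega>))\<bar> \<partial>M)"
        by (rule integral_abs_bound)
      also have "\<dots> \<le> (\<integral>\<omega>. e / 4 \<partial>M)"
        using close Y0 intM hM(1) by (intro integral_mono) (auto simp: g_eq)
      finally show ?thesis using intM hM(1) by (simp add: M.prob_space)
    qed
    have B: "\<bar>(\<integral>\<omega>. cts_step x y (Z \<omega>) \<partial>N) - (\<integral>\<omega>. h (exp (- Z \<omega>)) \<partial>N)\<bar> \<le> e / 4"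
    proof -
      have "\<bar>\<integral>\<omega>. cts_step x y (Z \<omega>) - h (exp (- Z \<omega>)) \<partial>N\<bar>
          \<le> (\<integral>\<omega>. \<bar>cts_step x y (Z \<omega>) - h (exp (- Z \<omega>))\<bar> \<partial>N)"
        by (rule integral_abs_bound)
      also have "\<dots> \<le> (\<integral>\<omega>. e / 4 \<partial>N)"
        using close Z0 intN hN(1) by (intro integral_mono) (auto simp: g_eq)
      finally show ?thesis using intN hN(1) by (simp add: N.prob_space)
    qed
    show "\<exists>n0. \<forall>n\<ge>n0. norm ((\<integral>\<omega>. cts_step x y (Y n \<omega>) \<partial>M) - (\<integral>\<omega>. cts_step x y (Z \<omega>) \<partial>N)) < e"
    proof (intro exI allI impI)
      fix n assume "n0 \<le> n"
      from A[of n] B n0[OF this] show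
        "norm ((\<integral>\<omega>. cts_step x y (Y n \<omega>) \<partial>M) - (\<integral>\<omega>. cts_step x y (Z \<omega>) \<partial>N)) < e"
        using e unfolding real_norm_def by linarith
    qed
  qed
  then show "(\<lambda>n. integral\<^sup>L (distr M borel (Y n)) (cts_step x y)) \<longlonglongrightarrow>
      integral\<^sup>L (distr N borel Z) (cts_step x y)"
    by (simp add: integral_distr)
qed

section \<open>The integral of squared Brownian motion\<close>

text \<open>Once the mesh is below the modulus of uniform continuity for e / 2, each of the m cells
  contributes an error of at most e / (2m).\<close>

lemma riemann_sum_tendsto:
  fixes f :: "real \<Rightarrow> real"
  assumes cont: "continuous_on {0..1} f"
  shows "(\<lambda>m. (\<Sum>j<m. f (real j / real m)) / real m) \<longlonglongrightarrow> (LBINT t:{0..1}. f t)"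
proof (rule LIMSEQ_I)
  have int: "f integrable_on {a..b}" if "0 \<le> a" "b \<le> 1" for a b
    using that by (intro integrable_continuous_interval continuous_on_subset[OF cont]) auto
  have "set_integrable lborel {0..1} f"
    using cont by (rule borel_integrable_atLeastAtMost')
  then have LB: "(LBINT t:{0..1}. f t) = integral {0..1} f"
    by (simp add: set_borel_integral_eq_integral)
  fix e :: real assume e: "0 < e"
  obtain d where d: "d > 0" "\<And>x y. x \<in> {0..1} \<Longrightarrow> y \<in> {0..1} \<Longrightarrow> dist y x < d \<Longrightarrow> dist (f y) (f x) < e / 2"
    using compact_uniformly_continuous[OF cont compact_Icc] e unfolding uniformly_continuous_on_def
    by (metis half_gt_zero)
  obtain n0 :: nat where n0: "1 / d < real n0" using reals_Archimedean2 by blast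
  show "\<exists>n0. \<forall>m\<ge>n0. norm ((\<Sum>j<m. f (real j / real m)) / real m - (LBINT t:{0..1}. f t)) < e"
  proof (intro exI allI impI)
    fix m assume m: "n0 \<le> m"
    then have m0: "m > 0" "1 / real m < d"
    proof -
      have nm: "1 / d < real m" using n0 m by linarith
      moreover have "0 < 1 / d" using d(1) by simp
      ultimately have "0 < real m" by linarith
      then show "m > 0" "1 / real m < d" using nm d(1) by (auto simp: field_simps)
    qed
    define g where "g j = real j / real m" for j
    have g_step: "g (Suc j) = g j + 1 / real m" for j by (simp add: g_def add_divide_distrib)
    \<comment> \<open>Induction on the number of cells treated, with the integral taken only up to
      the grid point \<open>g k\<close>.\<close>
    have "\<bar>integral {0..g k} f - (\<Sum>j<k. f (g j)) / real m\<bar> \<le> real k * (e / 2 / real m)" if "k \<le> m" for k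
      using that
    proof (induction k)
      case 0
      then show ?case by (simp add: g_def)
    next
      case (Suc k)
      have g01: "0 \<le> g k" "g k \<le> g (Suc k)" "g (Suc k) \<le> 1"
        using Suc.prems m0 by (auto simp: g_def divide_simps)
      have split: "integral {0..g (Suc k)} f = integral {0..g k} f + integral {g k..g (Suc k)} f"
        using g01 int by (intro Henstock_Kurzweil_Integration.integral_combine[symmetric]) auto
      have "((\<lambda>x. f x - f (g k)) has_integral
          (integral {g k..g (Suc k)} f - (g (Suc k) - g k) * f (g k))) {g k..g (Suc k)}"
        using has_integral_const_real[of "f (g k)" "g k" "g (Suc k)"] g01 int[of "g k" "g (Suc k)"]
        by (intro has_integral_diff integrable_integral) auto
      then have "norm (integral {g k..g (Suc k)} f - (g (Suc k) - g k) * f (g k)) \<le> e / 2 * Henstock_Kurzweil_Integration.content {g k..g (Suc k)}"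
      proof (rule has_integral_bound_real[rotated 2])
        show "0 \<le> e / 2" using e by simp
        show "finite ({} :: real set)" by simp
        fix x assume "x \<in> {g k..g (Suc k)} - {}"
        then have x: "x \<in> {g k..g (Suc k)}" by simp
        have "dist x (g k) < d" using x m0 g_step[of k] by (auto simp: dist_real_def)
        then show "norm (f x - f (g k)) \<le> e / 2"
          using d(2)[of "g k" x] x g01 by (auto simp: dist_real_def)
      qed
      then have "\<bar>integral {g k..g (Suc k)} f - f (g k) / real m\<bar> \<le> e / 2 / real m"
        using g01 by (simp add: g_step)
      moreover have "\<bar>integral {0..g k} f - (\<Sum>j<k. f (g j)) / real m\<bar> \<le> real k * (e / 2 / real m)"
        using Suc.IH Suc.prems by simp
      moreover have "(\<Sum>j<Suc k. f (g j)) / real m = (\<Sum>j<k. f (g j)) / real m + f (g k) / real m"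
        by (simp add: add_divide_distrib)
      moreover have "real (Suc k) * (e / 2 / real m) = real k * (e / 2 / real m) + e / 2 / real m"
        by (simp only: of_nat_Suc distrib_right mult_1_left)
      ultimately show ?case
        unfolding split by linarith
    qed
    from this[of m] m0 have "\<bar>integral {0..1} f - (\<Sum>j<m. f (g j)) / real m\<bar> \<le> e / 2"
      by (simp add: g_def)
    then show "norm ((\<Sum>j<m. f (real j / real m)) / real m - (LBINT t:{0..1}. f t)) < e"
      unfolding LB g_def using e by (simp add: abs_minus_commute)
  qed
qed

section \<open>Integrating out one Gaussian increment\<close>

text \<open>By independence the joint law is a product measure, so Fubini applies. The first
  argument will be the past of the Gaussian walk and the second its next increment.\<close>

lemma (in prob_space) expectation_indep_var:
  fixes f :: "'b \<times> 'b \<Rightarrow> real"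
  assumes ind: "indep_var S X T Y" and f[measurable]: "f \<in> borel_measurable (S \<Otimes>\<^sub>M T)"
    and bd: "\<And>u. \<bar>f u\<bar> \<le> C"
  shows "expectation (\<lambda>\<omega>. f (X \<omega>, Y \<omega>)) = expectation (\<lambda>\<omega>. expectation (\<lambda>\<omega>'. f (X \<omega>, Y \<omega>')))"
proof -
  have [measurable]: "random_variable S X" "random_variable T Y"
    using indep_var_rv1[OF ind] indep_var_rv2[OF ind] by auto
  interpret X: prob_space "distr M S X" by (rule prob_space_distr) simp
  interpret Y: prob_space "distr M T Y" by (rule prob_space_distr) simp
  interpret XY: pair_prob_space "distr M S X" "distr M T Y" ..
  have int: "integrable (distr M S X \<Otimes>\<^sub>M distr M T Y) f"
    using bd by (intro XY.P.integrable_const_bound[of _ C]) (auto simp: measurable_distr_eq1)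
  have "expectation (\<lambda>\<omega>. f (X \<omega>, Y \<omega>)) = (\<integral>u. f u \<partial>distr M (S \<Otimes>\<^sub>M T) (\<lambda>\<omega>. (X \<omega>, Y \<omega>)))"
    by (subst integral_distr) auto
  also have "distr M (S \<Otimes>\<^sub>M T) (\<lambda>\<omega>. (X \<omega>, Y \<omega>)) = distr M S X \<Otimes>\<^sub>M distr M T Y"
    using ind unfolding indep_var_distribution_eq by simp
  also have "(\<integral>u. f u \<partial>(distr M S X \<Otimes>\<^sub>M distr M T Y)) = (\<integral>x. (\<integral>y. f (x, y) \<partial>distr M T Y) \<partial>distr M S X)"
    using XY.integral_fst'[OF int] by simp
  also have "\<dots> = (\<integral>x. expectation (\<lambda>\<omega>'. f (x, Y \<omega>')) \<partial>distr M S X)"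
    by (intro Bochner_Integration.integral_cong refl integral_distr) auto
  also have "\<dots> = expectation (\<lambda>\<omega>. expectation (\<lambda>\<omega>'. f (X \<omega>, Y \<omega>')))"
    by (subst integral_distr) (auto intro!: borel_measurable_lebesgue_integral)
  finally show ?thesis .
qed

text \<open>The function exp(- a u^2 / 2) is a multiple of the normal density of variance 1 / a, so
  the expectation is a convolution of two centered normal densities evaluated at - x. The case a =
  0, where that variance would be infinite, is separate.\<close>

lemma (in prob_space) expectation_exp_square_normal:
  assumes \<sigma>: "0 < \<sigma>" and D: "distributed M lborel Y (normal_density 0 \<sigma>)" and a: "0 \<le> a"
  shows "expectation (\<lambda>\<omega>. exp (- (a * (x + Y \<omega>)\<^sup>2 / 2)))
    = exp (- (a * x\<^sup>2 / (2 * (1 + a * \<sigma>\<^sup>2)))) / sqrt (1 + a * \<sigma>\<^sup>2)"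
proof (cases "a = 0")
  case True
  then show ?thesis by (simp add: prob_space)
next
  case False
  with a have a: "0 < a" by simp
  define \<tau> where "\<tau> = 1 / sqrt a"
  have \<tau>: "0 < \<tau>" "\<tau>\<^sup>2 = 1 / a" using a by (auto simp: \<tau>_def power_divide)
  define \<kappa> where "\<kappa> = sqrt (2 * pi * \<tau>\<^sup>2)"
  have \<kappa>: "0 < \<kappa>" using \<tau> a by (simp add: \<kappa>_def)
  have ndens: "exp (- (a * u\<^sup>2 / 2)) = \<kappa> * normal_density 0 \<tau> u" for u
    using \<kappa> a by (simp add: normal_density_def \<kappa>_def \<tau>(2) field_simps)
  have sym: "normal_density 0 \<tau> (x + y) = normal_density 0 \<tau> (- x - y)" for y
    by (simp add: normal_density_def power2_eq_square algebra_simps)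
  have "expectation (\<lambda>\<omega>. exp (- (a * (x + Y \<omega>)\<^sup>2 / 2)))
      = (\<integral>y. normal_density 0 \<sigma> y * exp (- (a * (x + y)\<^sup>2 / 2)) \<partial>lborel)"
    by (rule distributed_integral[OF D, symmetric]) auto
  also have "\<dots> = (\<integral>y. \<kappa> * (normal_density 0 \<tau> (- x - y) * normal_density 0 \<sigma> y) \<partial>lborel)"
    by (simp only: ndens sym mult_ac)
  also have "\<dots> = \<kappa> * (\<integral>y. normal_density 0 \<tau> (- x - y) * normal_density 0 \<sigma> y \<partial>lborel)"
    by simp
  also have "(\<integral>y. normal_density 0 \<tau> (- x - y) * normal_density 0 \<sigma> y \<partial>lborel)
      = enn2real (\<integral>\<^sup>+y. ennreal (normal_density 0 \<tau> (- x - y) * normal_density 0 \<sigma> y) \<partial>lborel)"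
    by (rule integral_eq_nn_integral) auto
  also have "\<dots> = normal_density 0 (sqrt (\<tau>\<^sup>2 + \<sigma>\<^sup>2)) (- x)"
    using fun_cong[OF conv_normal_density_zero_mean[OF \<tau>(1) \<sigma>], of "- x"] by simp
  also have "\<kappa> * \<dots> = exp (- (a * x\<^sup>2 / (2 * (1 + a * \<sigma>\<^sup>2)))) / sqrt (1 + a * \<sigma>\<^sup>2)"
  proof -
    have s: "\<tau>\<^sup>2 + \<sigma>\<^sup>2 = (1 + a * \<sigma>\<^sup>2) / a" using a by (simp add: \<tau>(2) field_simps)
    have p: "0 < 1 + a * \<sigma>\<^sup>2" using a by (simp add: add_pos_nonneg)
    have "normal_density 0 (sqrt (\<tau>\<^sup>2 + \<sigma>\<^sup>2)) (- x)
        = 1 / sqrt (2 * pi * ((1 + a * \<sigma>\<^sup>2) / a)) * exp (- x\<^sup>2 / (2 * ((1 + a * \<sigma>\<^sup>2) / a)))"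
      unfolding normal_density_def s using p a by simp
    moreover have "- x\<^sup>2 / (2 * ((1 + a * \<sigma>\<^sup>2) / a)) = - (a * x\<^sup>2 / (2 * (1 + a * \<sigma>\<^sup>2)))"
      by (simp add: field_simps)
    moreover have "\<kappa> * (1 / sqrt (2 * pi * ((1 + a * \<sigma>\<^sup>2) / a))) = 1 / sqrt (1 + a * \<sigma>\<^sup>2)"
      unfolding \<kappa>_def \<tau>(2) using p a by (simp add: real_sqrt_mult real_sqrt_divide)
    ultimately show ?thesis by (simp only: mult.assoc[symmetric]) simp
  qed
  finally show ?thesis .
qed

text \<open>Integrating out a normal increment of variance h sends the coefficient a to a / (1 + a
  h) and costs ln(1 + a h) / 2. Together with the weight z^2 h x^2 / 2 this is one discrete step of
  the Riccati system, compared here with its exact flow over time h. An error of order h^2 is small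
  enough to be summed over 1 / h steps.\<close>

lemma gaussian_step_exponent:
  fixes x z r h :: real
  assumes z: "0 \<le> z" and r: "0 \<le> r" and h: "0 \<le> h"
  defines "a \<equiv> riccati z r"
  shows "\<bar>(- (z\<^sup>2 / 2 * h * x\<^sup>2) + log_weight z r - ln (1 + a * h) / 2 - a * x\<^sup>2 / (2 * (1 + a * h)))
      - (log_weight z (r + h) - riccati z (r + h) * x\<^sup>2 / 2)\<bar>
    \<le> (2 * z ^ 3 * x\<^sup>2 + z\<^sup>2) * h\<^sup>2"
proof -
  define w where "w = a * h"
  have a: "0 \<le> a" "a \<le> z" using riccati_bounds[OF z r] by (auto simp: a_def)
  have w: "0 \<le> w" "w \<le> z * h" using a h by (auto simp: w_def mult_right_mono)
  define e where "e = riccati z (r + h) - a - h * (z\<^sup>2 - a\<^sup>2)"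
  have e: "\<bar>e\<bar> \<le> 2 * z ^ 3 * h\<^sup>2" using riccati_taylor[OF z r h] by (simp add: e_def a_def)
  define e2 where "e2 = log_weight z (r + h) - log_weight z r + h * a / 2"
  have e2: "\<bar>e2\<bar> \<le> z\<^sup>2 * h\<^sup>2 / 2" using log_weight_taylor[OF z r h] by (simp add: e2_def a_def)
  have w2: "w\<^sup>2 \<le> z\<^sup>2 * h\<^sup>2" using w power_mono[of w "z * h" 2] by (simp add: power_mult_distrib)
  define E1 where "E1 = e / 2 - a / 2 * (w\<^sup>2 / (1 + w))"
  have "0 \<le> a / 2 * (w\<^sup>2 / (1 + w))" using a w by simp
  moreover have "a / 2 * (w\<^sup>2 / (1 + w)) \<le> z / 2 * (z\<^sup>2 * h\<^sup>2)"
  proof -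
    have "w\<^sup>2 / (1 + w) \<le> w\<^sup>2 / 1" using w by (intro divide_left_mono) auto
    then show ?thesis using a w w2 z by (intro mult_mono) auto
  qed
  ultimately have E1: "\<bar>E1\<bar> \<le> 2 * z ^ 3 * h\<^sup>2"
    using e z unfolding E1_def by (simp add: power2_eq_square power3_eq_cube)
  \<comment> \<open>For w > 1 the left side is negative, so the logarithmic bound valid on [0,1] is
    only needed there.\<close>
  have lnb: "w - w\<^sup>2 \<le> ln (1 + w)"
  proof (cases "w \<le> 1")
    case True
    then show ?thesis using w ln_one_plus_pos_lower_bound by blast
  next
    case False
    then have "w \<le> w\<^sup>2" using power_increasing[of 1 2 w] by simp
    moreover have "0 \<le> ln (1 + w)" using w by simp
    ultimately show ?thesis by linarith
  qed
  have ln: "0 \<le> w - ln (1 + w)" "w - ln (1 + w) \<le> w\<^sup>2"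
    using ln_add_one_self_le_self[OF w(1)] lnb w by auto
  define E2 where "E2 = (w - ln (1 + w)) / 2 - e2"
  have E2: "\<bar>E2\<bar> \<le> z\<^sup>2 * h\<^sup>2" 
  proof -
    have "- (z\<^sup>2 * h\<^sup>2 / 2) \<le> e2" "e2 \<le> z\<^sup>2 * h\<^sup>2 / 2" using e2 by (auto simp only: abs_le_iff)
    then show ?thesis using ln w2 unfolding E2_def abs_le_iff by (auto simp: field_simps)
  qed
  have r1: "riccati z (r + h) = a + h * (z\<^sup>2 - a\<^sup>2) + e" by (simp add: e_def)
  have p1: "log_weight z (r + h) = log_weight z r - w / 2 + e2" by (simp add: e2_def w_def)
  obtain T where T: "T = w\<^sup>2 / (1 + w)" by blast
  obtain l where l: "l = ln (1 + w)" by blast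
  \<comment> \<open>This is 1 / (1 + w) = 1 - w + w^2 / (1 + w): the terms of order 0 and 1 match
    the Riccati step and the last one enters the error \<open>E1\<close>.\<close>
  have V: "a * x\<^sup>2 / (2 * (1 + w)) = x\<^sup>2 * (a / 2 - a * w / 2 + a / 2 * T)"
    using w unfolding T by (simp add: field_simps power2_eq_square)
  have "(- (z\<^sup>2 / 2 * h * x\<^sup>2) + log_weight z r - ln (1 + w) / 2 - a * x\<^sup>2 / (2 * (1 + w)))
      - (log_weight z (r + h) - riccati z (r + h) * x\<^sup>2 / 2) = x\<^sup>2 * E1 + E2"
    unfolding r1 p1 E1_def E2_def V T[symmetric] l[symmetric]
    by (simp add: w_def field_simps power2_eq_square)
  also have "\<bar>\<dots>\<bar> \<le> x\<^sup>2 * (2 * z ^ 3 * h\<^sup>2) + z\<^sup>2 * h\<^sup>2"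
    using E1 E2 by (intro order_trans[OF abs_triangle_ineq] add_mono) (auto simp: abs_mult mult_left_mono)
  finally show ?thesis by (simp add: w_def algebra_simps)
qed

context standard_brownian_motion
begin

lemma increment_second_moment:
  assumes "0 \<le> t"
  shows "integrable N (\<lambda>\<omega>. (B t \<omega> - B 0 \<omega>)\<^sup>2)" "expectation (\<lambda>\<omega>. (B t \<omega> - B 0 \<omega>)\<^sup>2) = t"
proof -
  have "integrable N (\<lambda>\<omega>. (B t \<omega> - B 0 \<omega>)\<^sup>2) \<and> expectation (\<lambda>\<omega>. (B t \<omega> - B 0 \<omega>)\<^sup>2) = t"
  \<comment> \<open>Normal increments are given only for s < u, as the law at t = 0 has no
    density.\<close>
  proof (cases "t = 0")
    case True
    then show ?thesis by simp
  next
    case False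
    with assms have t: "0 < t" "0 < sqrt t" by auto
    have D: "distributed N lborel (\<lambda>\<omega>. B t \<omega> - B 0 \<omega>) (normal_density 0 (sqrt t))"
      using normal_increments[of 0 t] t by simp
    have "integrable lborel (\<lambda>x. normal_density 0 (sqrt t) x * x\<^sup>2)"
      using integrable_normal_moment[OF t(2), of 0 2] by simp
    then have "integrable N (\<lambda>\<omega>. (B t \<omega> - B 0 \<omega>)\<^sup>2)"
      using distributed_integrable[OF D, of "\<lambda>x. x\<^sup>2"] by simp
    moreover have "expectation (\<lambda>\<omega>. (B t \<omega> - B 0 \<omega>)\<^sup>2) = t"
      using distributed_integral[OF D, of "\<lambda>x. x\<^sup>2"] integral_normal_moment_even[OF t(2), of 0 1] t
      by simp
    ultimately show ?thesis by simp
  qed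
  then show "integrable N (\<lambda>\<omega>. (B t \<omega> - B 0 \<omega>)\<^sup>2)" "expectation (\<lambda>\<omega>. (B t \<omega> - B 0 \<omega>)\<^sup>2) = t"
    by auto
qed

text \<open>The sum over j < \<open>Suc i\<close> involves the path only up to time i / m, so the
  increment after that time is independent of it and can be integrated out. Subtracting
  \<open>B 0\<close> makes \<open>W j\<close> a sum of increments for every outcome, whereas
  \<open>B 0\<close> vanishes only almost surely.\<close>

lemma gaussian_step:
  fixes m i :: nat and a c :: real
  assumes i: "i < m" and a: "0 \<le> a" and c: "0 \<le> c"
  defines "W \<equiv> \<lambda>j \<omega>. B (real j / real m) \<omega> - B 0 \<omega>"
  shows "expectation (\<lambda>\<omega>. exp (- (c * (\<Sum>j<Suc i. (W j \<omega>)\<^sup>2))) * exp (- (a * (W (Suc i) \<omega>)\<^sup>2 / 2)))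
    = expectation (\<lambda>\<omega>. exp (- (c * (\<Sum>j<Suc i. (W j \<omega>)\<^sup>2)))
        * (exp (- (a * (W i \<omega>)\<^sup>2 / (2 * (1 + a * (1 / real m))))) / sqrt (1 + a * (1 / real m))))"
proof -
  define D where "D j \<omega> = B (real (Suc j) / real m) \<omega> - B (real j / real m) \<omega>" for j \<omega>
  have m: "0 < m" using i by simp
  have ind: "indep_vars (\<lambda>_. borel) D {..<m}"
    using indep_increments[of "\<lambda>i. real i / real m" m]
    unfolding D_def[abs_def] by (simp add: mono_def divide_right_mono)
  have indR: "indep_var (PiM {..<i} (\<lambda>_. borel)) (\<lambda>\<omega>. restrict (\<lambda>j. D j \<omega>) {..<i})
      (PiM {i} (\<lambda>_. borel)) (\<lambda>\<omega>. restrict (\<lambda>j. D j \<omega>) {i})"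
    using i by (intro indep_var_restrict[OF ind]) auto
  define w :: "(nat \<Rightarrow> real) \<Rightarrow> nat \<Rightarrow> real" where "w u j = (\<Sum>l<j. u l)" for u j
  have w_meas: "(\<lambda>u. w u j) \<in> borel_measurable (PiM {..<i} (\<lambda>_. borel))" if "j \<le> i" for j
    unfolding w_def using that by (intro borel_measurable_sum measurable_component_singleton) auto
  have W: "(\<Sum>l<j. D l \<omega>) = W j \<omega>" for j \<omega>
    unfolding D_def W_def by (induction j) auto
  have wW: "w (restrict (\<lambda>j. D j \<omega>) {..<i}) j = W j \<omega>" if "j \<le> i" for j \<omega>
    unfolding W[symmetric] w_def using that by (intro sum.cong) auto
  \<comment> \<open>Here u stands for the first i increments, from which \<open>w u j\<close>
    rebuilds \<open>W j\<close>, and v carries the single increment with index i.\<close>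
  define f :: "(nat \<Rightarrow> real) \<times> (nat \<Rightarrow> real) \<Rightarrow> real" where
    "f = (\<lambda>(u, v). exp (- (c * (\<Sum>j<Suc i. (w u j)\<^sup>2))) * exp (- (a * (w u i + v i)\<^sup>2 / 2)))"
  have f_meas: "f \<in> borel_measurable (PiM {..<i} (\<lambda>_. borel) \<Otimes>\<^sub>M PiM {i} (\<lambda>_. borel))"
  proof -
    have 1: "(\<lambda>p. w (fst p) j) \<in> borel_measurable (PiM {..<i} (\<lambda>_. borel) \<Otimes>\<^sub>M PiM {i} (\<lambda>_. borel :: real measure))"
      if "j \<le> i" for j
      by (rule measurable_compose[OF measurable_fst w_meas[OF that]])
    have "(\<lambda>v. v i) \<in> borel_measurable (PiM {i} (\<lambda>_. borel :: real measure))"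
      by (intro measurable_component_singleton) auto
    then have 2: "(\<lambda>p. snd p i) \<in> borel_measurable (PiM {..<i} (\<lambda>_. borel :: real measure) \<Otimes>\<^sub>M PiM {i} (\<lambda>_. borel :: real measure))"
      by (rule measurable_compose[OF measurable_snd])
    show ?thesis
      unfolding f_def case_prod_beta
      by (intro borel_measurable_times measurable_compose[OF _ borel_measurable_exp]
          borel_measurable_uminus borel_measurable_sum borel_measurable_power borel_measurable_const
          borel_measurable_divide borel_measurable_add 1 2) auto
  qed
  have f_bd: "\<bar>f u\<bar> \<le> 1" for u
    unfolding f_def case_prod_beta abs_mult using a c
    by (intro mult_le_one) (auto intro!: mult_nonneg_nonneg add_nonneg_nonneg sum_nonneg)
  have DD: "distributed N lborel (D i) (normal_density 0 (sqrt (1 / real m)))"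
  proof -
    have "real (Suc i) / real m - real i / real m = 1 / real m"
      by (simp add: diff_divide_distrib[symmetric])
    then show ?thesis
      using normal_increments[of "real i / real m" "real (Suc i) / real m"] m
      unfolding D_def[abs_def] by (simp add: divide_strict_right_mono)
  qed
  have "expectation (\<lambda>\<omega>. f (restrict (\<lambda>j. D j \<omega>) {..<i}, restrict (\<lambda>j. D j \<omega>) {i}))
     = expectation (\<lambda>\<omega>. expectation (\<lambda>\<omega>'. f (restrict (\<lambda>j. D j \<omega>) {..<i}, restrict (\<lambda>j. D j \<omega>') {i})))"
    by (rule expectation_indep_var[OF indR f_meas f_bd])
  also have "\<dots> = expectation (\<lambda>\<omega>. exp (- (c * (\<Sum>j<Suc i. (W j \<omega>)\<^sup>2))) *
      expectation (\<lambda>\<omega>'. exp (- (a * (W i \<omega> + D i \<omega>')\<^sup>2 / 2))))"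
    unfolding f_def by (simp add: wW)
  also have "\<dots> = expectation (\<lambda>\<omega>. exp (- (c * (\<Sum>j<Suc i. (W j \<omega>)\<^sup>2)))
        * (exp (- (a * (W i \<omega>)\<^sup>2 / (2 * (1 + a * (1 / real m))))) / sqrt (1 + a * (1 / real m))))"
    using expectation_exp_square_normal[OF _ DD a] m by simp
  also have "(\<lambda>\<omega>. f (restrict (\<lambda>j. D j \<omega>) {..<i}, restrict (\<lambda>j. D j \<omega>) {i}))
      = (\<lambda>\<omega>. exp (- (c * (\<Sum>j<Suc i. (W j \<omega>)\<^sup>2))) * exp (- (a * (W (Suc i) \<omega>)\<^sup>2 / 2)))"
    by (rule ext) (simp add: f_def wW W[of _ "Suc i", symmetric] W[of _ i, symmetric])
  finally show ?thesis .
qed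

lemma measurable_increment [measurable]: "(\<lambda>\<omega>. B (real j / real m) \<omega> - B 0 \<omega>) \<in> borel_measurable N"
  by (intro borel_measurable_diff measurable_B) auto

text \<open>The expectations of \<open>\<Phi> i\<close> interpolate between the closed form at i =
  0, where all the time remains, and the transform of the Riemann sum at i = m, where none remains.
  Each of the m steps costs O(1 / m^2).\<close>

lemma discrete_laplace:
  fixes m :: nat and z :: real
  assumes m: "0 < m" and z: "0 \<le> z"
  defines "W \<equiv> \<lambda>j \<omega>. B (real j / real m) \<omega> - B 0 \<omega>"
  shows "\<bar>expectation (\<lambda>\<omega>. exp (- (z\<^sup>2 / 2 * ((\<Sum>j<m. (W j \<omega>)\<^sup>2) / real m)))) - 1 / sqrt (cosh z)\<bar>
    \<le> (2 * z ^ 3 + z\<^sup>2) / real m"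
proof -
  define h where "h = 1 / real m"
  have h: "0 < h" "real m * h = 1" using m by (auto simp: h_def)
  \<comment> \<open>Time remaining after i steps. A step is read backwards:
    \<open>gaussian_step_exponent\<close> is applied at \<open>r (Suc i)\<close>, and
    \<open>r i\<close> exceeds it by h.\<close>
  define r where "r i = 1 - real i * h" for i
  define c where "c = z\<^sup>2 / 2 * h"
  have c: "0 \<le> c" using h by (simp add: c_def)
  define U where "U i \<omega> = exp (- (c * (\<Sum>j<i. (W j \<omega>)\<^sup>2)))" for i \<omega>
  \<comment> \<open>The weight accumulated so far times the Cameron-Martin value of the remaining
    time.\<close>
  define \<Phi> where "\<Phi> i \<omega> = U i \<omega> * exp (log_weight z (r i) - riccati z (r i) * (W i \<omega>)\<^sup>2 / 2)" for i \<omega>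
  have [measurable]: "W j \<in> borel_measurable N" for j unfolding W_def by measurable
  have [measurable]: "U i \<in> borel_measurable N" for i unfolding U_def by measurable
  have [measurable]: "\<Phi> i \<in> borel_measurable N" for i unfolding \<Phi>_def by measurable
  have U: "0 \<le> U i \<omega>" "U i \<omega> \<le> 1" for i \<omega>
    using c by (auto simp: U_def intro!: mult_nonneg_nonneg sum_nonneg)
  have r0: "0 \<le> r i" if "i \<le> m" for i
    using that m by (simp add: r_def h_def)
  have \<Phi>_int: "integrable N (\<Phi> i)" if "i \<le> m" for i
  proof (rule integrable_const_bound[of _ 1])
    have "exp (log_weight z (r i) - riccati z (r i) * (W i \<omega>)\<^sup>2 / 2) \<le> 1" for \<omega>
      using log_weight_nonpos[of z "r i"] riccati_bounds(1)[OF z r0[OF that]]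
      by (auto intro: order_trans[of _ 0])
    then show "AE \<omega> in N. norm (\<Phi> i \<omega>) \<le> 1"
      using U by (auto simp: \<Phi>_def abs_mult intro!: mult_le_one)
  qed simp
  have step: "\<bar>expectation (\<Phi> (Suc i)) - expectation (\<Phi> i)\<bar> \<le> (2 * z ^ 3 + z\<^sup>2) * h\<^sup>2" if i: "i < m" for i
  proof -
    define a where "a = riccati z (r (Suc i))"
    have a: "0 \<le> a" using riccati_bounds(1)[OF z r0[of "Suc i"]] i by (simp add: a_def)
    have ah: "0 < 1 + a * h" using a h by (simp add: add_pos_nonneg)
    define P where "P \<omega> = log_weight z (r (Suc i)) - ln (1 + a * h) / 2 - a * (W i \<omega>)\<^sup>2 / (2 * (1 + a * h))" for \<omega>
    define Q where "Q \<omega> = log_weight z (r i) - riccati z (r i) * (W i \<omega>)\<^sup>2 / 2" for \<omega>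
    have [measurable]: "P \<in> borel_measurable N" unfolding P_def by measurable
    have P0: "P \<omega> \<le> 0" for \<omega>
    proof -
      have "0 \<le> ln (1 + a * h)" using a h by simp
      moreover have "0 \<le> a * (W i \<omega>)\<^sup>2 / (2 * (1 + a * h))" using a ah by simp
      ultimately show ?thesis using log_weight_nonpos[of z "r (Suc i)"] unfolding P_def by linarith
    qed
    have Q0: "Q \<omega> \<le> 0" for \<omega>
      using log_weight_nonpos[of z "r i"] riccati_bounds(1)[OF z r0[of i]] i
      by (auto simp: Q_def intro: order_trans[of _ 0])
    have ri: "r i = r (Suc i) + h" by (simp add: r_def algebra_simps)
    have US: "U (Suc i) \<omega> = U i \<omega> * exp (- (c * (W i \<omega>)\<^sup>2))" for \<omega>
      by (simp add: U_def exp_add[symmetric] algebra_simps)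
    have int1: "integrable N (\<lambda>\<omega>. U (Suc i) \<omega> * exp (P \<omega>))"
      using U P0 by (intro integrable_const_bound[of _ 1]) (auto simp: abs_mult intro!: mult_le_one)
    have sq: "exp (- (ln (1 + a * h) / 2)) = 1 / sqrt (1 + a * h)"
      using ah by (simp add: exp_minus ln_sqrt[symmetric] inverse_eq_divide)
    have "\<Phi> (Suc i) = (\<lambda>\<omega>. exp (log_weight z (r (Suc i))) *
        (U (Suc i) \<omega> * exp (- (a * (W (Suc i) \<omega>)\<^sup>2 / 2))))"
      by (rule ext, unfold \<Phi>_def a_def diff_conv_add_uminus exp_add) (simp only: mult_ac minus_mult_left times_divide_eq_left)
    then have "expectation (\<Phi> (Suc i)) = exp (log_weight z (r (Suc i))) *
        expectation (\<lambda>\<omega>. U (Suc i) \<omega> * exp (- (a * (W (Suc i) \<omega>)\<^sup>2 / 2)))"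
      by (simp only: integral_mult_right_zero)
    also have "\<dots> = exp (log_weight z (r (Suc i))) * expectation (\<lambda>\<omega>. U (Suc i) \<omega>
        * (exp (- (a * (W i \<omega>)\<^sup>2 / (2 * (1 + a * h)))) / sqrt (1 + a * h)))"
      using gaussian_step[OF i a c] unfolding U_def W_def h_def by simp
    also have "\<dots> = expectation (\<lambda>\<omega>. U (Suc i) \<omega> * exp (P \<omega>))"
    proof -
      have "exp (P \<omega>) = exp (log_weight z (r (Suc i))) * (exp (- (a * (W i \<omega>)\<^sup>2 / (2 * (1 + a * h)))) / sqrt (1 + a * h))" for \<omega>
      proof -
        have "exp (P \<omega>) = exp (log_weight z (r (Suc i)) + - (ln (1 + a * h) / 2) + - (a * (W i \<omega>)\<^sup>2 / (2 * (1 + a * h))))"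
          by (simp add: P_def)
        then show ?thesis unfolding exp_add sq by simp
      qed
      then have "(\<lambda>\<omega>. U (Suc i) \<omega> * exp (P \<omega>)) = (\<lambda>\<omega>. exp (log_weight z (r (Suc i))) *
          (U (Suc i) \<omega> * (exp (- (a * (W i \<omega>)\<^sup>2 / (2 * (1 + a * h)))) / sqrt (1 + a * h))))"
        by (simp only: mult_ac)
      then show ?thesis by (simp only: integral_mult_right_zero)
    qed
    finally have e1: "expectation (\<Phi> (Suc i)) = expectation (\<lambda>\<omega>. U (Suc i) \<omega> * exp (P \<omega>))" .
    \<comment> \<open>The common factor \<open>U i\<close> is at most 1, and both remaining
      exponents are nonpositive, so their difference bounds the difference of the
      exponentials.\<close>
    have bd: "\<bar>U (Suc i) \<omega> * exp (P \<omega>) - \<Phi> i \<omega>\<bar> \<le> (2 * z ^ 3 * (W i \<omega>)\<^sup>2 + z\<^sup>2) * h\<^sup>2" for \<omega>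
    proof -
      have "U (Suc i) \<omega> * exp (P \<omega>) - \<Phi> i \<omega> = U i \<omega> * (exp (- (c * (W i \<omega>)\<^sup>2) + P \<omega>) - exp (Q \<omega>))"
        by (simp only: US \<Phi>_def Q_def exp_add right_diff_distrib mult_ac)
      then have "\<bar>U (Suc i) \<omega> * exp (P \<omega>) - \<Phi> i \<omega>\<bar> = U i \<omega> * \<bar>exp (- (c * (W i \<omega>)\<^sup>2) + P \<omega>) - exp (Q \<omega>)\<bar>"
        using U(1)[of i \<omega>] by (simp add: abs_mult)
      also have "\<dots> \<le> 1 * \<bar>exp (- (c * (W i \<omega>)\<^sup>2) + P \<omega>) - exp (Q \<omega>)\<bar>"
        using U by (intro mult_right_mono) auto
      also have "\<dots> \<le> \<bar>(- (c * (W i \<omega>)\<^sup>2) + P \<omega>) - Q \<omega>\<bar>"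
        unfolding mult_1 using P0[of \<omega>] Q0[of \<omega>] mult_nonneg_nonneg[OF c zero_le_power2[of "W i \<omega>"]]
        by (intro abs_exp_diff_le) linarith+
      also have "\<dots> \<le> (2 * z ^ 3 * (W i \<omega>)\<^sup>2 + z\<^sup>2) * h\<^sup>2"
        using gaussian_step_exponent[OF z r0[of "Suc i"] less_imp_le[OF h(1)], of "W i \<omega>"] i
        unfolding P_def Q_def a_def c_def ri by (simp add: algebra_simps)
      finally show ?thesis .
    qed
    have i01: "0 \<le> real i / real m" "real i / real m \<le> 1" using i by auto
    have W2: "integrable N (\<lambda>\<omega>. (W i \<omega>)\<^sup>2)" "expectation (\<lambda>\<omega>. (W i \<omega>)\<^sup>2) \<le> 1"
      using increment_second_moment[OF i01(1)] i01(2) by (auto simp: W_def)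
    have "\<bar>expectation (\<Phi> (Suc i)) - expectation (\<Phi> i)\<bar>
        = \<bar>expectation (\<lambda>\<omega>. U (Suc i) \<omega> * exp (P \<omega>) - \<Phi> i \<omega>)\<bar>"
      unfolding e1 using int1 \<Phi>_int[of i] i by simp
    also have "\<dots> \<le> expectation (\<lambda>\<omega>. \<bar>U (Suc i) \<omega> * exp (P \<omega>) - \<Phi> i \<omega>\<bar>)"
      by (rule integral_abs_bound)
    also have "\<dots> \<le> expectation (\<lambda>\<omega>. (2 * z ^ 3 * (W i \<omega>)\<^sup>2 + z\<^sup>2) * h\<^sup>2)"
      using int1 \<Phi>_int[of i] i W2(1) bd by (intro integral_mono) auto
    also have "\<dots> = (2 * z ^ 3 * expectation (\<lambda>\<omega>. (W i \<omega>)\<^sup>2) + z\<^sup>2) * h\<^sup>2"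
      using W2(1) by (simp add: prob_space)
    also have "\<dots> \<le> (2 * z ^ 3 * 1 + z\<^sup>2) * h\<^sup>2"
      using W2(2) z by (intro mult_right_mono add_mono mult_left_mono) auto
    finally show ?thesis by simp
  qed
  have "\<bar>expectation (\<Phi> k) - expectation (\<Phi> 0)\<bar> \<le> real k * ((2 * z ^ 3 + z\<^sup>2) * h\<^sup>2)" if "k \<le> m" for k
    using that
  proof (induction k)
    case (Suc k)
    then show ?case using step[of k] by (simp add: algebra_simps)
  qed simp
  note tel = this[of m, OF order_refl]
  have "\<bar>expectation (\<Phi> m) - expectation (\<Phi> 0)\<bar> \<le> (2 * z ^ 3 + z\<^sup>2) * h"
  proof -
    have "real m * ((2 * z ^ 3 + z\<^sup>2) * h\<^sup>2) = (2 * z ^ 3 + z\<^sup>2) * h * (real m * h)"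
      by (simp only: power2_eq_square mult_ac)
    with tel show ?thesis by (simp only: h(2) mult_1_right)
  qed
  moreover have "expectation (\<Phi> 0) = 1 / sqrt (cosh z)"
  proof -
    have "\<Phi> 0 = (\<lambda>\<omega>. 1 / sqrt (cosh z))"
      by (simp add: fun_eq_iff \<Phi>_def U_def W_def r_def exp_log_weight)
    then show ?thesis by (simp add: prob_space)
  qed
  moreover have "\<Phi> m = (\<lambda>\<omega>. exp (- (z\<^sup>2 / 2 * ((\<Sum>j<m. (W j \<omega>)\<^sup>2) / real m))))"
    using h(2) by (simp add: \<Phi>_def U_def r_def c_def h_def fun_eq_iff)
  ultimately show ?thesis by (simp add: h_def)
qed

lemma integral_of_square_nonneg: "0 \<le> integral_of_square B \<omega>"
  unfolding integral_of_square_def set_lebesgue_integral_def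
  by (intro Bochner_Integration.integral_nonneg) auto

lemma riemann_sums_integral_of_square:
  assumes "\<omega> \<in> space N"
  shows "(\<lambda>m. (\<Sum>j<m. (B (real j / real m) \<omega>)\<^sup>2) / real m) \<longlonglongrightarrow> integral_of_square B \<omega>"
  unfolding integral_of_square_def
  using continuous_on_subset[OF continuous_paths[OF assms], of "{0..1}"]
  by (intro riemann_sum_tendsto continuous_on_power) auto

text \<open>A pointwise limit of measurable Riemann sums; the convergence holds at every outcome
  because every path is continuous.\<close>

lemma measurable_integral_of_square [measurable]: "integral_of_square B \<in> borel_measurable N"
proof (rule borel_measurable_LIMSEQ_real)
  show "(\<lambda>m. (\<Sum>j<m. (B (real j / real m) \<omega>)\<^sup>2) / real m) \<longlonglongrightarrow> integral_of_square B \<omega>"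
    if "\<omega> \<in> space N" for \<omega>
    using that by (rule riemann_sums_integral_of_square)
  show "(\<lambda>\<omega>. (\<Sum>j<m. (B (real j / real m) \<omega>)\<^sup>2) / real m) \<in> borel_measurable N" for m :: nat
    by (intro borel_measurable_divide borel_measurable_sum borel_measurable_power measurable_B
        borel_measurable_const) auto
qed

text \<open>Dominated convergence along the Riemann sums, whose transforms are known up to O(1 /
  m).\<close>

lemma laplace_integral_of_square:
  assumes z: "0 \<le> z"
  shows "expectation (\<lambda>\<omega>. exp (- (z\<^sup>2 / 2 * integral_of_square B \<omega>))) = 1 / sqrt (cosh z)"
proof -
  define E where "E m \<omega> = exp (- (z\<^sup>2 / 2 * ((\<Sum>j<m. (B (real j / real m) \<omega> - B 0 \<omega>)\<^sup>2) / real m)))" for m \<omega>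
  have "(\<lambda>m. expectation (E m)) \<longlonglongrightarrow> expectation (\<lambda>\<omega>. exp (- (z\<^sup>2 / 2 * integral_of_square B \<omega>)))"
  proof (rule integral_dominated_convergence[where w = "\<lambda>_. 1"])
    show "AE \<omega> in N. (\<lambda>m. E m \<omega>) \<longlonglongrightarrow> exp (- (z\<^sup>2 / 2 * integral_of_square B \<omega>))"
      using starts_at_0 AE_space
    proof eventually_elim
      case (elim \<omega>)
      then show ?case
        using tendsto_exp[OF tendsto_minus[OF tendsto_mult[OF tendsto_const[of "z\<^sup>2 / 2"]
            riemann_sums_integral_of_square[of \<omega>]]]]
        by (simp add: E_def)
    qed
    show "AE \<omega> in N. norm (E m \<omega>) \<le> 1" for m
      by (auto simp: E_def intro!: AE_I2 mult_nonneg_nonneg divide_nonneg_nonneg sum_nonneg)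
    show "E m \<in> borel_measurable N" for m
      unfolding E_def by measurable
  qed auto
  moreover have "(\<lambda>m. expectation (E m)) \<longlonglongrightarrow> 1 / sqrt (cosh z)"
  proof (rule LIM_zero_cancel)
    show "(\<lambda>m. expectation (E m) - 1 / sqrt (cosh z)) \<longlonglongrightarrow> 0"
    proof (rule Lim_null_comparison)
      show "\<forall>\<^sub>F m in sequentially. norm (expectation (E m) - 1 / sqrt (cosh z)) \<le> (2 * z ^ 3 + z\<^sup>2) / real m"
        using eventually_gt_at_top[of 0]
        by eventually_elim (use discrete_laplace[OF _ z] in \<open>simp add: E_def[abs_def]\<close>)
      show "(\<lambda>m. (2 * z ^ 3 + z\<^sup>2) / real m) \<longlonglongrightarrow> 0" by (rule lim_const_over_n)
    qed
  qed
  ultimately show ?thesis by (rule LIMSEQ_unique)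
qed

end

section \<open>Moments of the elephant random walk\<close>

context elephant_random_walk
begin

text \<open>The filtration as a measure space, so that being known at time n is ordinary
  measurability with respect to \<open>past n\<close>.\<close>

definition past :: "nat \<Rightarrow> 'a measure" where
  "past n = sigma (space M) (\<Union>i\<in>{1..n}. {X i -` C \<inter> space M | C. C \<in> sets borel})"

lemma sets_past:
  "sets (past n) = sigma_sets (space M) (\<Union>i\<in>{1..n}. {X i -` C \<inter> space M | C. C \<in> sets borel})"
  unfolding past_def by (intro sets_measure_of) auto

lemma space_past [simp]: "space (past n) = space M"
  unfolding past_def by (intro space_measure_of) auto

text \<open>Measurability is assumed outright only for \<open>X 1\<close>. For the later steps it is
  extracted from \<open>choice_indep\<close>, since independent families consist of events.\<close>

lemma sets_past_subset: "n \<ge> 1 \<Longrightarrow> sets (past n) \<subseteq> events"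
  using indep_setD_ev1[OF choice_indep] unfolding sets_past by blast

lemma measurable_X_past: "1 \<le> i \<Longrightarrow> i \<le> n \<Longrightarrow> X i \<in> borel_measurable (past n)"
  by (rule measurableI) (auto simp: sets_past intro!: sigma_sets.Basic bexI[of _ i] exI)

lemma measurable_pastD: "n \<ge> 1 \<Longrightarrow> f \<in> borel_measurable (past n) \<Longrightarrow> f \<in> borel_measurable M"
  using sets_past_subset[of n] measurable_sets[of f "past n" borel]
  by (intro measurableI) auto

lemma measurable_X [measurable]: "n \<ge> 1 \<Longrightarrow> random_variable borel (X n)"
  using measurable_pastD measurable_X_past by blast

lemma measurable_position_past:
  "m \<le> n \<Longrightarrow> erw_position X m \<in> borel_measurable (past n)"
  unfolding erw_position_def[abs_def] by (intro borel_measurable_sum measurable_X_past) auto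

lemma measurable_position [measurable]: "random_variable borel (erw_position X n)"
  unfolding erw_position_def[abs_def] by (intro borel_measurable_sum measurable_X) auto

lemma measurable_V [measurable]: "random_variable borel (erw_V X n)"
  unfolding erw_V_def[abs_def] by measurable

lemma measurable_choice:
  assumes "n \<ge> 1"
  shows "(\<lambda>\<omega>. (K n \<omega>, R n \<omega>)) \<in> measurable M (count_space UNIV)"
proof (rule measurableI)
  fix A :: "(nat \<times> bool) set"
  have "(\<lambda>\<omega>. (K n \<omega>, R n \<omega>)) -` A \<inter> space M
      \<in> sets (vimage_algebra (space M) (\<lambda>\<omega>. (K n \<omega>, R n \<omega>)) (count_space UNIV))"
    by (rule in_vimage_algebra) simp
  then show "(\<lambda>\<omega>. (K n \<omega>, R n \<omega>)) -` A \<inter> space M \<in> events"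
    using indep_setD_ev2[OF choice_indep[OF assms]] by blast
qed simp

lemma AE_K_range: "n \<ge> 1 \<Longrightarrow> AE \<omega> in M. K n \<omega> \<in> {1..n}"
proof -
  assume n: "n \<ge> 1"
  have "AE x in distr M (count_space UNIV) (\<lambda>\<omega>. (K n \<omega>, R n \<omega>)). fst x \<in> {1..n}"
    unfolding choice_distr[OF n] using n by (auto simp: AE_measure_pmf_iff set_pmf_of_set)
  from AE_distrD[OF measurable_choice[OF n] this] show ?thesis by simp
qed

text \<open>Strong induction, as the next step copies up to sign a step at an arbitrary earlier
  time.\<close>

lemma AE_X_values: "n \<ge> 1 \<Longrightarrow> AE \<omega> in M. X n \<omega> = 1 \<or> X n \<omega> = -1"
proof (induction n rule: less_induct)
  case (less n)
  show ?case
  proof (cases "n = 1")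
    case True
    have [measurable]: "{\<omega> \<in> space M. X 1 \<omega> = 1} \<in> events" "{\<omega> \<in> space M. X 1 \<omega> = -1} \<in> events"
      using first_step_measurable by measurable
    have "prob ({\<omega> \<in> space M. X 1 \<omega> = 1} \<union> {\<omega> \<in> space M. X 1 \<omega> = -1}) = 1"
      by (subst finite_measure_Union) (auto simp: first_step[simplified])
    then have "AE \<omega> in M. \<omega> \<in> {\<omega> \<in> space M. X 1 \<omega> = 1} \<union> {\<omega> \<in> space M. X 1 \<omega> = -1}"
      by (subst prob_eq_1[symmetric]) auto
    then show ?thesis unfolding True by eventually_elim auto
  next
    case False
    then obtain m where n: "n = Suc m" and m: "m \<ge> 1" using less.prems by (cases n) auto
    have "AE \<omega> in M. \<forall>j\<in>{1..m}. X j \<omega> = 1 \<or> X j \<omega> = -1"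
      using less.IH n by (intro AE_finite_allI) auto
    with AE_K_range[OF m] AE_space show ?thesis
    proof eventually_elim
      case (elim \<omega>)
      then show ?case using next_step[OF m, of \<omega>] n by auto
    qed
  qed
qed

lemma AE_abs_position_le: "AE \<omega> in M. \<bar>erw_position X n \<omega>\<bar> \<le> real n"
proof -
  have "AE \<omega> in M. \<forall>j\<in>{1..n}. X j \<omega> = 1 \<or> X j \<omega> = -1"
    using AE_X_values by (intro AE_finite_allI) auto
  then show ?thesis
  proof eventually_elim
    case (elim \<omega>)
    have "\<bar>erw_position X n \<omega>\<bar> \<le> (\<Sum>k=1..n. \<bar>X k \<omega>\<bar>)" unfolding erw_position_def by (rule sum_abs)
    also have "\<dots> \<le> (\<Sum>k=1..n. 1)" using elim by (intro sum_mono) fastforce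
    finally show ?case by simp
  qed
qed

lemma AE_position_powers_le: "AE \<omega> in M. \<bar>erw_position X n \<omega> ^ i\<bar> \<le> real n ^ i"
  using AE_abs_position_le[of n] by eventually_elim (simp add: power_abs power_mono)

lemma integrable_position_powers: "integrable M (\<lambda>\<omega>. erw_position X n \<omega> ^ i)"
  using AE_position_powers_le by (intro integrable_const_bound[of _ "real n ^ i"]) auto

lemma position_Suc: "erw_position X (Suc n) \<omega> = erw_position X n \<omega> + X (Suc n) \<omega>"
  by (simp add: erw_position_def)

text \<open>The time j is chosen with probability 1 / n, and the independent sign has mean p - (1 -
  p).\<close>

lemma choice_sign_expectation:
  assumes n: "n \<ge> 1" and j: "j \<in> {1..n}"
  shows "expectation (\<lambda>\<omega>. if K n \<omega> = j then (if R n \<omega> then 1 else - 1) else 0) = (2 * p - 1) / real n"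
proof -
  define f :: "nat \<times> bool \<Rightarrow> real" where "f = (\<lambda>(k, r). if k = j then (if r then 1 else - 1) else 0)"
  have "expectation (\<lambda>\<omega>. if K n \<omega> = j then (if R n \<omega> then 1 else - 1) else 0)
      = (\<integral>x. f x \<partial>distr M (count_space UNIV) (\<lambda>\<omega>. (K n \<omega>, R n \<omega>)))"
    using measurable_choice[OF n] by (subst integral_distr) (auto simp: f_def)
  also have "\<dots> = (\<integral>x. f x \<partial>measure_pmf (pair_pmf (pmf_of_set {1..n}) (bernoulli_pmf p)))"
    unfolding choice_distr[OF n] ..
  also have "\<dots> = (\<Sum>x\<in>{(j, True), (j, False)}. pmf (pair_pmf (pmf_of_set {1..n}) (bernoulli_pmf p)) x *\<^sub>R f x)"
    by (rule integral_measure_pmf) (auto simp: f_def split: if_splits)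
  also have "\<dots> = (2 * p - 1) / real n"
    using j n p_range by (simp add: f_def pmf_pair field_simps)
  finally show ?thesis .
qed

text \<open>The conditional mean (2p - 1) S(n) / n of the next step, in weak form: tested against
  integrable G known at time n. All information about the dynamics enters the moment and transform
  estimates through this identity and the values 1 and -1 of the steps.\<close>

lemma expectation_next_step:
  assumes n: "n \<ge> 1" and G: "G \<in> borel_measurable (past n)" and int: "integrable M G"
  shows "expectation (\<lambda>\<omega>. G \<omega> * X (Suc n) \<omega>)
    = (2 * p - 1) / real n * expectation (\<lambda>\<omega>. G \<omega> * erw_position X n \<omega>)"
proof -
  \<comment> \<open>Since the remembered time lies in 1..n almost surely, the next step is the sum
    over j of \<open>X j\<close> times \<open>Z j\<close>. In each summand G * \<open>X j\<close>
    belongs to the past and \<open>Z j\<close> depends on the choice alone, so expectations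
    factor.\<close>
  define Z where "Z j \<omega> = (if K n \<omega> = j then (if R n \<omega> then 1 else - 1) else (0::real))" for j \<omega>
  let ?V = "vimage_algebra (space M) (\<lambda>\<omega>. (K n \<omega>, R n \<omega>)) (count_space UNIV)"
  have Z: "Z j \<in> borel_measurable ?V" for j
  proof -
    have "(\<lambda>\<omega>. (K n \<omega>, R n \<omega>)) \<in> measurable ?V (count_space UNIV)"
      by (rule measurable_vimage_algebra1) simp
    then have "(\<lambda>\<omega>. (\<lambda>(k, r). if k = j then (if r then 1 else - 1) else (0::real)) (K n \<omega>, R n \<omega>))
        \<in> borel_measurable ?V"
      by (rule measurable_compose) simp
    then show ?thesis by (simp add: Z_def[abs_def])
  qed
  have Z_M: "Z j \<in> borel_measurable M" for j
    using measurable_sets[OF Z] indep_setD_ev2[OF choice_indep[OF n]]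
    by (intro measurableI) auto
  have GX: "(\<lambda>\<omega>. G \<omega> * X j \<omega>) \<in> borel_measurable (past n)" if "j \<in> {1..n}" for j
    using G measurable_X_past[of j n] that by (intro borel_measurable_times) auto
  have ind: "indep_var borel (\<lambda>\<omega>. G \<omega> * X j \<omega>) borel (Z j)" if j: "j \<in> {1..n}" for j
    unfolding indep_var_eq
  proof (intro conjI)
    show "random_variable borel (\<lambda>\<omega>. G \<omega> * X j \<omega>)" using measurable_pastD[OF n GX[OF j]] .
    show "random_variable borel (Z j)" by (rule Z_M)
    have 1: "sigma_sets (space M) {(\<lambda>\<omega>. G \<omega> * X j \<omega>) -` A \<inter> space M |A. A \<in> sets borel} \<subseteq> sets (past n)"
    proof -
      have "{(\<lambda>\<omega>. G \<omega> * X j \<omega>) -` A \<inter> space M |A. A \<in> sets borel} \<subseteq> sets (past n)"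
        using measurable_sets[OF GX[OF j]] unfolding space_past by blast
      from sets.sigma_sets_subset[OF this] show ?thesis unfolding space_past .
    qed
    have 2: "sigma_sets (space M) {Z j -` A \<inter> space M |A. A \<in> sets borel} \<subseteq> sets ?V"
    proof -
      have "{Z j -` A \<inter> space M |A. A \<in> sets borel} \<subseteq> sets ?V"
        using measurable_sets[OF Z[of j]] unfolding space_vimage_algebra by blast
      from sets.sigma_sets_subset[OF this] show ?thesis unfolding space_vimage_algebra .
    qed
    show "indep_set (sigma_sets (space M) {(\<lambda>\<omega>. G \<omega> * X j \<omega>) -` A \<inter> space M |A. A \<in> sets borel})
       (sigma_sets (space M) {Z j -` A \<inter> space M |A. A \<in> sets borel})"
      using choice_indep[OF n] 1 2 unfolding indep_sets2_eq sets_past by blast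
  qed
  have intX: "integrable M (\<lambda>\<omega>. G \<omega> * X j \<omega>)" if j: "j \<in> {1..n}" for j
  proof (rule Bochner_Integration.integrable_bound[OF int])
    show "(\<lambda>\<omega>. G \<omega> * X j \<omega>) \<in> borel_measurable M" using measurable_pastD[OF n GX[OF j]] .
    show "AE \<omega> in M. norm (G \<omega> * X j \<omega>) \<le> norm (G \<omega>)"
      using AE_X_values[of j] j by (auto elim!: eventually_mono)
  qed
  have intZ: "integrable M (Z j)" for j
    using Z_M by (intro integrable_const_bound[of _ 1]) (auto simp: Z_def)
  have EZ: "expectation (Z j) = (2 * p - 1) / real n" if "j \<in> {1..n}" for j
    using choice_sign_expectation[OF n that] by (simp add: Z_def[abs_def])
  have "expectation (\<lambda>\<omega>. G \<omega> * X (Suc n) \<omega>) = expectation (\<lambda>\<omega>. \<Sum>j\<in>{1..n}. (G \<omega> * X j \<omega>) * Z j \<omega>)"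
  proof (rule integral_cong_AE)
    show "(\<lambda>\<omega>. G \<omega> * X (Suc n) \<omega>) \<in> borel_measurable M"
      using measurable_pastD[OF n G] by measurable
    show "(\<lambda>\<omega>. \<Sum>j\<in>{1..n}. (G \<omega> * X j \<omega>) * Z j \<omega>) \<in> borel_measurable M"
      using measurable_pastD[OF n G] Z_M by (intro borel_measurable_sum borel_measurable_times measurable_X) auto
    show "AE \<omega> in M. G \<omega> * X (Suc n) \<omega> = (\<Sum>j\<in>{1..n}. (G \<omega> * X j \<omega>) * Z j \<omega>)"
      using AE_K_range[OF n] AE_space
    proof eventually_elim
      case (elim \<omega>)
      have "(\<Sum>j\<in>{1..n}. (G \<omega> * X j \<omega>) * Z j \<omega>)
          = (\<Sum>j\<in>{1..n}. if K n \<omega> = j then G \<omega> * X j \<omega> * (if R n \<omega> then 1 else - 1) else 0)"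
        by (intro sum.cong) (auto simp: Z_def)
      also have "\<dots> = G \<omega> * X (K n \<omega>) \<omega> * (if R n \<omega> then 1 else - 1)"
        using elim(1) by (subst sum.delta') auto
      finally show ?case using next_step[OF n, of \<omega>] elim(2) by simp
    qed
  qed
  also have "\<dots> = (\<Sum>j\<in>{1..n}. expectation (\<lambda>\<omega>. (G \<omega> * X j \<omega>) * Z j \<omega>))"
    using indep_var_integrable[OF ind intX intZ] by (intro Bochner_Integration.integral_sum) auto
  also have "\<dots> = (\<Sum>j\<in>{1..n}. expectation (\<lambda>\<omega>. G \<omega> * X j \<omega>) * ((2 * p - 1) / real n))"
    using indep_var_lebesgue_integral[OF ind intX intZ] EZ by (intro sum.cong) auto
  also have "\<dots> = (2 * p - 1) / real n * (\<Sum>j\<in>{1..n}. expectation (\<lambda>\<omega>. G \<omega> * X j \<omega>))"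
    by (simp add: sum_distrib_left mult.commute)
  also have "(\<Sum>j\<in>{1..n}. expectation (\<lambda>\<omega>. G \<omega> * X j \<omega>)) = expectation (\<lambda>\<omega>. \<Sum>j\<in>{1..n}. G \<omega> * X j \<omega>)"
    using intX by (intro Bochner_Integration.integral_sum[symmetric]) auto
  also have "(\<lambda>\<omega>. \<Sum>j\<in>{1..n}. G \<omega> * X j \<omega>) = (\<lambda>\<omega>. G \<omega> * erw_position X n \<omega>)"
    by (simp add: erw_position_def sum_distrib_left)
  finally show ?thesis .
qed

lemma integrable_times_next_step:
  assumes "integrable M G"
  shows "integrable M (\<lambda>\<omega>. G \<omega> * X (Suc n) \<omega>)"
proof (rule Bochner_Integration.integrable_bound[OF assms])
  show "(\<lambda>\<omega>. G \<omega> * X (Suc n) \<omega>) \<in> borel_measurable M" using assms by measurable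
  show "AE \<omega> in M. norm (G \<omega> * X (Suc n) \<omega>) \<le> norm (G \<omega>)"
    using AE_X_values[of "Suc n"] by (auto elim!: eventually_mono)
qed

lemma expectation_position_power_next:
  assumes "n \<ge> 1"
  shows "expectation (\<lambda>\<omega>. erw_position X n \<omega> ^ i * X (Suc n) \<omega>)
    = (2 * p - 1) / real n * expectation (\<lambda>\<omega>. erw_position X n \<omega> ^ Suc i)"
  using expectation_next_step[OF assms borel_measurable_power[OF measurable_position_past[OF order_refl]] 
      integrable_position_powers[of n i]]
  by (simp add: mult.commute)

lemma second_moment_Suc:
  assumes n: "n \<ge> 1"
  shows "expectation (\<lambda>\<omega>. (erw_position X (Suc n) \<omega>)\<^sup>2)
    = (1 + 2 * (2 * p - 1) / real n) * expectation (\<lambda>\<omega>. (erw_position X n \<omega>)\<^sup>2) + 1"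
proof -
  let ?S = "erw_position X n"
  have "expectation (\<lambda>\<omega>. (erw_position X (Suc n) \<omega>)\<^sup>2)
      = expectation (\<lambda>\<omega>. (?S \<omega>)\<^sup>2 + 2 * (?S \<omega> ^ 1 * X (Suc n) \<omega>) + 1)"
    using AE_X_values[of "Suc n"]
    by (intro integral_cong_AE) (auto elim!: eventually_mono simp: position_Suc power2_eq_square algebra_simps)
  also have "\<dots> = expectation (\<lambda>\<omega>. (?S \<omega>)\<^sup>2) + 2 * expectation (\<lambda>\<omega>. ?S \<omega> ^ 1 * X (Suc n) \<omega>) + 1"
    using integrable_position_powers[of n 2] integrable_times_next_step[OF integrable_position_powers[of n 1], of n]
    by (simp add: prob_space)
  also have "\<dots> = (1 + 2 * (2 * p - 1) / real n) * expectation (\<lambda>\<omega>. (?S \<omega>)\<^sup>2) + 1"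
    unfolding expectation_position_power_next[OF n] by (simp add: numeral_2_eq_2 algebra_simps)
  finally show ?thesis .
qed

lemma second_moment_1: "expectation (\<lambda>\<omega>. (erw_position X 1 \<omega>)\<^sup>2) = 1"
proof -
  have "expectation (\<lambda>\<omega>. (erw_position X 1 \<omega>)\<^sup>2) = expectation (\<lambda>\<omega>. 1)"
    using AE_X_values[of 1] by (intro integral_cong_AE) (auto elim!: eventually_mono simp: erw_position_def)
  then show ?thesis by (simp add: prob_space)
qed

section \<open>Almost sure convergence for p < 3/4\<close>

lemma second_moment_linear:
  assumes p: "p < 3 / 4"
  shows "\<exists>C\<ge>1. \<forall>n\<ge>1. expectation (\<lambda>\<omega>. (erw_position X n \<omega>)\<^sup>2) \<le> C * real n"
proof -
  \<comment> \<open>The maximum with 0 keeps the growth factor 1 + 2 a / n nonnegative when p < 1/2;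
    the condition 2 a < 1 is where p < 3/4 enters.\<close>
  define a where "a = max (2 * p - 1) 0"
  have a: "0 \<le> a" "2 * p - 1 \<le> a" "2 * a < 1" using p by (auto simp: a_def max_def)
  \<comment> \<open>The slope for which C n reproduces itself under the recursion: 2 a C + 1 =
    C.\<close>
  define C where "C = 1 / (1 - 2 * a)"
  have C: "1 \<le> C" "C * (1 - 2 * a) = 1" using a by (auto simp: C_def field_simps)
  have "expectation (\<lambda>\<omega>. (erw_position X n \<omega>)\<^sup>2) \<le> C * real n" if "n \<ge> 1" for n
    using that
  proof (induction n rule: dec_induct)
    case base
    then show ?case using C second_moment_1 by simp
  next
    case (step n)
    have n: "real n > 0" using step by simp
    have E0: "0 \<le> expectation (\<lambda>\<omega>. (erw_position X n \<omega>)\<^sup>2)" by simp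
    have "expectation (\<lambda>\<omega>. (erw_position X (Suc n) \<omega>)\<^sup>2)
        = (1 + 2 * (2 * p - 1) / real n) * expectation (\<lambda>\<omega>. (erw_position X n \<omega>)\<^sup>2) + 1"
      using second_moment_Suc step by simp
    also have "\<dots> \<le> (1 + 2 * a / real n) * expectation (\<lambda>\<omega>. (erw_position X n \<omega>)\<^sup>2) + 1"
      using a n E0 by (intro add_mono mult_right_mono) (auto simp: divide_right_mono)
    also have "\<dots> \<le> (1 + 2 * a / real n) * (C * real n) + 1"
      using a n step.IH by (intro add_mono mult_left_mono) auto
    also have "\<dots> = C * real n + 2 * a * C + 1"
      using n by (simp add: field_simps)
    also have "\<dots> = C * real n + 2 * a * C + C * (1 - 2 * a)"
      by (simp only: C(2))
    also have "\<dots> = C * real (Suc n)" by (simp add: algebra_simps)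
    finally show ?case .
  qed
  with C(1) show ?thesis by blast
qed

lemma V_nonneg: "0 \<le> erw_V X n \<omega>"
  by (simp add: erw_V_def sum_nonneg)

lemma V_mono: "m \<le> n \<Longrightarrow> erw_V X m \<omega> \<le> erw_V X n \<omega>"
  unfolding erw_V_def by (intro mult_left_mono sum_mono2) auto

lemma integrable_V: "integrable M (erw_V X n)"
  unfolding erw_V_def[abs_def] power_divide
  by (intro integrable_mult_right Bochner_Integration.integrable_sum integrable_divide integrable_position_powers)

text \<open>Dividing a second moment of order k by k^2 leaves a harmonic sum.\<close>

lemma expectation_V_le:
  assumes C: "\<And>n. n \<ge> 1 \<Longrightarrow> expectation (\<lambda>\<omega>. (erw_position X n \<omega>)\<^sup>2) \<le> C * real n" and "0 \<le> C"
  shows "expectation (erw_V X n) \<le> 4 * C * harm n"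
proof -
  have "expectation (erw_V X n) = 4 * (\<Sum>k=1..<n. expectation (\<lambda>\<omega>. (erw_position X k \<omega>)\<^sup>2) / (real k)\<^sup>2)"
    unfolding erw_V_def[abs_def] power_divide
    using integrable_position_powers by (subst integral_mult_right_zero) (subst Bochner_Integration.integral_sum, auto)
  also have "\<dots> \<le> 4 * (\<Sum>k=1..<n. C * inverse (real k))"
  proof (intro mult_left_mono sum_mono)
    fix k assume k: "k \<in> {1..<n}"
    then have "expectation (\<lambda>\<omega>. (erw_position X k \<omega>)\<^sup>2) / (real k)\<^sup>2 \<le> C * real k / (real k)\<^sup>2"
      using C[of k] by (intro divide_right_mono) auto
    then show "expectation (\<lambda>\<omega>. (erw_position X k \<omega>)\<^sup>2) / (real k)\<^sup>2 \<le> C * inverse (real k)"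
      using k by (simp add: power2_eq_square divide_inverse)
  qed simp
  also have "\<dots> \<le> 4 * (\<Sum>k=1..n. C * inverse (real k))"
    using assms(2) by (intro mult_left_mono sum_mono2) auto
  finally show ?thesis by (simp add: harm_def sum_distrib_left mult.assoc)
qed

end

text \<open>Monotonicity interpolates between the times 2^(2^j), at which the logarithm doubles.\<close>

lemma log_squared_normalized_tendsto_0:
  fixes V :: "nat \<Rightarrow> real"
  assumes mono: "\<And>m n. m \<le> n \<Longrightarrow> V m \<le> V n" and nonneg: "\<And>n. 0 \<le> V n"
    and lim: "(\<lambda>j. V (2 ^ 2 ^ j) / (ln (real (2 ^ 2 ^ j)))\<^sup>2) \<longlonglongrightarrow> 0"
  shows "(\<lambda>n. V n / (ln (real n))\<^sup>2) \<longlonglongrightarrow> 0"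
proof (rule LIMSEQ_I)
  define N :: "nat \<Rightarrow> nat" where "N j = 2 ^ 2 ^ j" for j
  have lnN: "ln (real (N j)) = 2 ^ j * ln 2" for j by (simp add: N_def ln_realpow)
  have N_ge: "j < N j" for j
  proof -
    have "j < 2 ^ j" "2 ^ j < (2::nat) ^ 2 ^ j" by (rule less_exp)+
    then show ?thesis unfolding N_def by (rule less_trans)
  qed
  have N_mono: "i \<le> j \<Longrightarrow> N i \<le> N j" for i j by (simp add: N_def power_increasing)
  fix e :: real assume e: "0 < e"
  obtain J where J: "\<And>j. j \<ge> J \<Longrightarrow> V (N j) / (ln (real (N j)))\<^sup>2 < e / 4"
    using LIMSEQ_D[OF lim, of "e / 4"] e nonneg by (fastforce simp: N_def)
  show "\<exists>n0. \<forall>n\<ge>n0. norm (V n / (ln (real n))\<^sup>2 - 0) < e"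
  proof (intro exI allI impI)
    fix n assume n: "n \<ge> N J"
    define j where "j = (LEAST j. n < N j)"
    have j: "n < N j" unfolding j_def using N_ge by (rule LeastI)
    \<comment> \<open>In particular j has a predecessor i \<ge> J, and minimality of j gives N i
      \<le> n < N j.\<close>
    have "J < j"
    proof (rule ccontr)
      assume "\<not> J < j"
      then have "N j \<le> N J" by (intro N_mono) simp
      with j n show False by simp
    qed
    then obtain i where i: "j = Suc i" "J \<le> i" by (cases j) auto
    have "\<not> n < N i" using not_less_Least[of i "\<lambda>j. n < N j"] i unfolding j_def by simp
    then have "N i \<le> n" by simp
    have "0 < ln (real (N i))" by (simp add: lnN)
    moreover have "ln (real (N i)) \<le> ln (real n)"
      using \<open>N i \<le> n\<close> N_ge[of i] by (subst ln_le_cancel_iff) auto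
    ultimately have l: "0 < (ln (real (N i)))\<^sup>2" "(ln (real (N i)))\<^sup>2 \<le> (ln (real n))\<^sup>2"
      by (auto intro: power_mono)
    have "V n / (ln (real n))\<^sup>2 \<le> V (N j) / (ln (real (N i)))\<^sup>2"
      using l mono[of n "N j"] j nonneg by (intro frac_le) auto
    \<comment> \<open>The logarithm doubles from N i to N j; its square accounts for the 4 and for
      the choice of e / 4 above.\<close>
    also have "\<dots> = 4 * (V (N j) / (ln (real (N j)))\<^sup>2)"
      unfolding lnN i by (simp add: power_mult_distrib field_simps)
    also have "\<dots> < e"
    proof -
      have "J \<le> j" using i by simp
      from J[OF this] show ?thesis by linarith
    qed
    finally show "norm (V n / (ln (real n))\<^sup>2 - 0) < e" using nonneg[of n] by simp
  qed
qed

context elephant_random_walk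
begin

lemma AE_V_tendsto_0:
  assumes p: "p < 3 / 4"
  shows "AE \<omega> in M. (\<lambda>n. erw_V X n \<omega> / (ln (real n))\<^sup>2) \<longlonglongrightarrow> 0"
proof -
  obtain C where C: "C \<ge> 1" "\<And>n. n \<ge> 1 \<Longrightarrow> expectation (\<lambda>\<omega>. (erw_position X n \<omega>)\<^sup>2) \<le> C * real n"
    using second_moment_linear[OF p] by blast
  define N :: "nat \<Rightarrow> nat" where "N j = 2 ^ 2 ^ j" for j
  have lnN: "ln (real (N j)) = 2 ^ j * ln 2" for j by (simp add: N_def ln_realpow)
  define U where "U j \<omega> = erw_V X (N j) \<omega> / (ln (real (N j)))\<^sup>2" for j \<omega>
  have U0: "0 \<le> U j \<omega>" for j \<omega> by (simp add: U_def V_nonneg)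
  have [measurable]: "U j \<in> borel_measurable M" for j unfolding U_def[abs_def] by measurable
  have intU: "integrable M (U j)" for j unfolding U_def[abs_def] using integrable_V by simp
  define D where "D = 8 * C / (ln 2)\<^sup>2"
  have D: "0 \<le> D" using C by (simp add: D_def)
  \<comment> \<open>The numerator grows like log N(j), which is of order 2^j, against a denominator
    of order 4^j.\<close>
  have EU: "expectation (U j) \<le> D * (1 / 2) ^ j" for j
  proof -
    have "harm (N j) \<le> 1 + ln (real (N j))"
      using euler_mascheroni_sequence_decreasing[of 1 "N j"] by (simp add: N_def harm_expand)
    also have "\<dots> \<le> 2 ^ j + 2 ^ j * 1"
      unfolding lnN using ln_2_less_1 by (intro add_mono mult_left_mono) auto
    finally have h: "harm (N j) \<le> (2 * 2 ^ j :: real)" by simp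
    have "expectation (U j) = expectation (erw_V X (N j)) / (ln (real (N j)))\<^sup>2"
      unfolding U_def[abs_def] by simp
    also have "\<dots> \<le> 4 * C * harm (N j) / (ln (real (N j)))\<^sup>2"
      using C by (intro divide_right_mono expectation_V_le) auto
    also have "\<dots> \<le> 4 * C * (2 * 2 ^ j) / (ln (real (N j)))\<^sup>2"
      using C h by (intro divide_right_mono mult_left_mono) auto
    also have "\<dots> = D * (1 / 2) ^ j"
      unfolding lnN D_def by (simp add: power_mult_distrib power2_eq_square field_simps power_divide)
    finally show ?thesis .
  qed
  \<comment> \<open>A sum of nonnegative variables with finite expectation is finite almost surely,
    which forces its terms to 0.\<close>
  have "(\<integral>\<^sup>+\<omega>. (\<Sum>j. ennreal (U j \<omega>)) \<partial>M) = (\<Sum>j. \<integral>\<^sup>+\<omega>. ennreal (U j \<omega>) \<partial>M)"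
    by (rule nn_integral_suminf) simp
  also have "\<dots> = (\<Sum>j. ennreal (expectation (U j)))"
    using U0 intU by (simp add: nn_integral_eq_integral)
  also have "\<dots> \<le> (\<Sum>j. ennreal (D * (1 / 2) ^ j))"
    by (intro suminf_le ennreal_leI EU) auto
  also have "\<dots> < top"
    using D by (subst suminf_ennreal2) (auto intro!: summable_mult summable_geometric)
  finally have "(\<integral>\<^sup>+\<omega>. (\<Sum>j. ennreal (U j \<omega>)) \<partial>M) \<noteq> \<infinity>" by auto
  then have "AE \<omega> in M. (\<Sum>j. ennreal (U j \<omega>)) \<noteq> \<infinity>"
    by (intro nn_integral_noteq_infinite) auto
  then show ?thesis
  proof eventually_elim
    case (elim \<omega>)
    then have "summable (\<lambda>j. U j \<omega>)"
      using U0 by (intro summable_suminf_not_top) auto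
    then have "(\<lambda>j. U j \<omega>) \<longlonglongrightarrow> 0" by (rule summable_LIMSEQ_zero)
    then show ?case
      unfolding U_def N_def by (intro log_squared_normalized_tendsto_0 V_mono V_nonneg)
  qed
qed

end

section \<open>The critical walk\<close>

text \<open>Here \<sigma> is S(k) / k, \<open>r\<close> is the time remaining after step k + 1, and
  - b is the coefficient of that step in the exponent. The first exponent arises when the step is
  averaged as if Gaussian with mean \<sigma> / 2; the second belongs to time k, with 1 / (k L) more
  time remaining. One error term is only of order 1 / L, but it is kept as a difference that
  telescopes over k.\<close>

lemma walk_step_exponent:
  fixes k :: nat and \<sigma> L z r :: real
  assumes z: "0 \<le> z" and r: "0 \<le> r" and k: "1 \<le> k" and L: "1 \<le> L" and \<sigma>: "\<sigma>\<^sup>2 \<le> 1"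
  defines "a \<equiv> riccati z r"
  defines "b \<equiv> a * (real k * \<sigma>) / ((real k + 1) * L)"
  shows "\<bar>(- (z\<^sup>2 / 2 / L\<^sup>2 * \<sigma>\<^sup>2) + (log_weight z r - a * ((real k * \<sigma>)\<^sup>2 + 1) / (2 * (real k + 1) * L))
        + (b\<^sup>2 / 2 - \<sigma> / 2 * b))
      - (log_weight z (r + 1 / (real k * L)) - riccati z (r + 1 / (real k * L)) * (real k * \<sigma>)\<^sup>2 / (2 * real k * L))\<bar>
    \<le> (z ^ 3 + 2 * z\<^sup>2) / L\<^sup>2 * (1 / real k) + z / (2 * L) * (1 / real k - 1 / (real k + 1))"
proof -
  define \<kappa> where "\<kappa> = real k"
  have \<kappa>: "1 \<le> \<kappa>" "0 < \<kappa>" "\<kappa> \<noteq> 0" "\<kappa> + 1 \<noteq> 0" using k by (auto simp: \<kappa>_def)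
  have L0: "0 < L" "L \<noteq> 0" using L by auto
  define h where "h = 1 / (\<kappa> * L)"
  have h: "0 \<le> h" using \<kappa> L by (simp add: h_def)
  have a: "0 \<le> a" "a \<le> z" using riccati_bounds[OF z r] by (auto simp: a_def)
  define e where "e = riccati z (r + h) - a - h * (z\<^sup>2 - a\<^sup>2)"
  have e: "\<bar>e\<bar> \<le> 2 * z ^ 3 * h\<^sup>2" using riccati_taylor[OF z r h] by (simp add: e_def a_def)
  define e2 where "e2 = log_weight z (r + h) - log_weight z r + h * a / 2"
  have e2: "\<bar>e2\<bar> \<le> z\<^sup>2 * h\<^sup>2 / 2" using log_weight_taylor[OF z r h] by (simp add: e2_def a_def)
  define T1 where "T1 = e * (\<kappa> * \<sigma>\<^sup>2 / (2 * L))"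
  define T2 where "T2 = a\<^sup>2 * \<sigma>\<^sup>2 / (2 * L\<^sup>2) * (1 - (\<kappa> / (\<kappa> + 1))\<^sup>2)"
  define T3 where "T3 = a / (2 * L) * (1 / \<kappa> - 1 / (\<kappa> + 1))"
  \<comment> \<open>The critical cancellation: the drift \<sigma> / 2, specific to p = 3/4, exactly
    compensates the change of normalization from k to k + 1 in the quadratic term.\<close>
  have t1: "a * ((\<kappa> * \<sigma>)\<^sup>2 + 1) / (2 * (\<kappa> + 1) * L) + \<sigma> / 2 * b
      = a * \<kappa> * \<sigma>\<^sup>2 / (2 * L) + a / (2 * L) * (1 / (\<kappa> + 1))"
  proof -
    have "a * ((\<kappa> * \<sigma>)\<^sup>2 + 1) / (2 * (\<kappa> + 1) * L) + \<sigma> / 2 * b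
        = a / (2 * L) * (((\<kappa> * \<sigma>)\<^sup>2 + 1) / (\<kappa> + 1) + \<kappa> * \<sigma>\<^sup>2 / (\<kappa> + 1))"
      unfolding b_def \<kappa>_def[symmetric] using \<kappa> L0 by (simp add: divide_simps) (simp add: algebra_simps power2_eq_square)
    also have "((\<kappa> * \<sigma>)\<^sup>2 + 1) / (\<kappa> + 1) + \<kappa> * \<sigma>\<^sup>2 / (\<kappa> + 1) = \<kappa> * \<sigma>\<^sup>2 + 1 / (\<kappa> + 1)"
      using \<kappa> by (simp add: divide_simps) (simp add: algebra_simps power2_eq_square)
    finally show ?thesis by (simp add: algebra_simps)
  qed
  have t2: "b\<^sup>2 / 2 = a\<^sup>2 * \<sigma>\<^sup>2 / (2 * L\<^sup>2) - T2"
  proof -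
    have "b = a * \<sigma> / L * (\<kappa> / (\<kappa> + 1))" by (simp add: b_def \<kappa>_def mult_ac)
    then have "b\<^sup>2 = a\<^sup>2 * \<sigma>\<^sup>2 / L\<^sup>2 * (\<kappa> / (\<kappa> + 1))\<^sup>2"
      by (simp only: power_mult_distrib power_divide)
    moreover have "T2 = a\<^sup>2 * \<sigma>\<^sup>2 / (2 * L\<^sup>2) - a\<^sup>2 * \<sigma>\<^sup>2 / (2 * L\<^sup>2) * (\<kappa> / (\<kappa> + 1))\<^sup>2"
      unfolding T2_def by (simp only: right_diff_distrib mult_1_right)
    ultimately show ?thesis by simp
  qed
  \<comment> \<open>The slope z^2 - a^2 produces two terms: one matches the weight z^2 \<sigma>^2 /
    (2 L^2), the other the Gaussian variance term in \<open>t2\<close>.\<close>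
  have t3: "riccati z (r + h) * (\<kappa> * \<sigma>)\<^sup>2 / (2 * \<kappa> * L)
      = a * \<kappa> * \<sigma>\<^sup>2 / (2 * L) + \<sigma>\<^sup>2 * (z\<^sup>2 - a\<^sup>2) / (2 * L\<^sup>2) + T1"
  proof -
    have r1: "riccati z (r + h) = a + h * (z\<^sup>2 - a\<^sup>2) + e" by (simp add: e_def)
    have q: "(\<kappa> * \<sigma>)\<^sup>2 / (2 * \<kappa> * L) = \<kappa> * \<sigma>\<^sup>2 / (2 * L)"
      using \<kappa> by (simp add: power2_eq_square)
    have hq: "h * (\<kappa> * \<sigma>\<^sup>2 / (2 * L)) = \<sigma>\<^sup>2 / (2 * L\<^sup>2)"
      using \<kappa> by (simp add: h_def power2_eq_square)
    have "riccati z (r + h) * (\<kappa> * \<sigma>)\<^sup>2 / (2 * \<kappa> * L) = riccati z (r + h) * (\<kappa> * \<sigma>\<^sup>2 / (2 * L))"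
      unfolding q[symmetric] by simp
    also have "\<dots> = a * (\<kappa> * \<sigma>\<^sup>2 / (2 * L)) + (z\<^sup>2 - a\<^sup>2) * (h * (\<kappa> * \<sigma>\<^sup>2 / (2 * L))) + T1"
    proof -
      have "(a + h * w + e) * Q = a * Q + w * (h * Q) + e * Q" for w Q :: real
        by (simp add: algebra_simps)
      then show ?thesis unfolding r1 T1_def .
    qed
    finally show ?thesis unfolding hq by (simp add: mult_ac)
  qed
  have t4: "log_weight z (r + h) = log_weight z r - h * a / 2 + e2" by (simp add: e2_def)
  have t5: "h * a / 2 = a / (2 * L) * (1 / \<kappa>)" by (simp add: h_def)
  have t6: "\<sigma>\<^sup>2 * (z\<^sup>2 - a\<^sup>2) / (2 * L\<^sup>2) = z\<^sup>2 / 2 / L\<^sup>2 * \<sigma>\<^sup>2 - a\<^sup>2 * \<sigma>\<^sup>2 / (2 * L\<^sup>2)"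
    by (simp add: diff_divide_distrib right_diff_distrib mult_ac)
  have t7: "T3 = a / (2 * L) * (1 / \<kappa>) - a / (2 * L) * (1 / (\<kappa> + 1))"
    unfolding T3_def by (rule right_diff_distrib)
  have "(- (z\<^sup>2 / 2 / L\<^sup>2 * \<sigma>\<^sup>2) + (log_weight z r - a * ((\<kappa> * \<sigma>)\<^sup>2 + 1) / (2 * (\<kappa> + 1) * L))
        + (b\<^sup>2 / 2 - \<sigma> / 2 * b))
      - (log_weight z (r + h) - riccati z (r + h) * (\<kappa> * \<sigma>)\<^sup>2 / (2 * \<kappa> * L)) = T1 - T2 + T3 - e2"
    using t1 t2 t3 t4 t5 t6 t7 by linarith
  moreover have "\<bar>T1\<bar> \<le> z ^ 3 / L\<^sup>2 * (1 / \<kappa>)"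
  proof -
    have "\<bar>T1\<bar> = \<bar>e\<bar> * (\<kappa> * \<sigma>\<^sup>2 / (2 * L))" using \<kappa> L0 by (simp add: T1_def abs_mult)
    also have "\<dots> \<le> (2 * z ^ 3 * h\<^sup>2) * (\<kappa> * 1 / (2 * L))"
      using e \<sigma> \<kappa> L0 z by (intro mult_mono divide_right_mono mult_left_mono) auto
    also have "\<dots> = z ^ 3 / L\<^sup>2 * (1 / \<kappa>) * (1 / L)"
      using \<kappa> L0 by (simp add: h_def power2_eq_square)
    also have "\<dots> \<le> z ^ 3 / L\<^sup>2 * (1 / \<kappa>) * 1"
      using z \<kappa> L by (intro mult_left_mono) auto
    finally show ?thesis by simp
  qed
  moreover have "0 \<le> T2 \<and> T2 \<le> z\<^sup>2 / L\<^sup>2 * (1 / \<kappa>)"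
  proof -
    have "1 - (\<kappa> / (\<kappa> + 1))\<^sup>2 = (1 - \<kappa> / (\<kappa> + 1)) * (1 + \<kappa> / (\<kappa> + 1))"
      by (simp add: power2_eq_square algebra_simps)
    also have "1 - \<kappa> / (\<kappa> + 1) = 1 / (\<kappa> + 1)" using \<kappa> by (simp add: field_simps)
    finally have f: "1 - (\<kappa> / (\<kappa> + 1))\<^sup>2 = 1 / (\<kappa> + 1) * (1 + \<kappa> / (\<kappa> + 1))" .
    have "1 / (\<kappa> + 1) * (1 + \<kappa> / (\<kappa> + 1)) \<le> 1 / \<kappa> * 2"
    proof (intro mult_mono)
      show "1 / (\<kappa> + 1) \<le> 1 / \<kappa>" using \<kappa> by (intro frac_le) auto
      have "\<kappa> / (\<kappa> + 1) \<le> 1" using \<kappa> by simp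
      then show "1 + \<kappa> / (\<kappa> + 1) \<le> 2" by linarith
    qed (use \<kappa> in auto)
    then have w: "0 \<le> 1 - (\<kappa> / (\<kappa> + 1))\<^sup>2" "1 - (\<kappa> / (\<kappa> + 1))\<^sup>2 \<le> 2 / \<kappa>"
      unfolding f using \<kappa> by auto
    have "a\<^sup>2 * \<sigma>\<^sup>2 \<le> z\<^sup>2 * 1" using a \<sigma> by (intro mult_mono power_mono) auto
    then have "a\<^sup>2 * \<sigma>\<^sup>2 / (2 * L\<^sup>2) \<le> z\<^sup>2 / (2 * L\<^sup>2)" by (simp add: divide_right_mono)
    then have "T2 \<le> z\<^sup>2 / (2 * L\<^sup>2) * (2 / \<kappa>)"
      unfolding T2_def using w by (intro mult_mono) auto
    then show ?thesis using w by (auto simp: T2_def)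
  qed
  moreover have "0 \<le> T3 \<and> T3 \<le> z / (2 * L) * (1 / \<kappa> - 1 / (\<kappa> + 1))"
  proof -
    have "0 \<le> 1 / \<kappa> - 1 / (\<kappa> + 1)" using \<kappa> by (simp add: field_simps)
    then show ?thesis unfolding T3_def using a L0 by (auto intro!: mult_right_mono divide_right_mono)
  qed
  moreover have "\<bar>e2\<bar> \<le> z\<^sup>2 / L\<^sup>2 * (1 / \<kappa>)"
  proof -
    have "z\<^sup>2 * h\<^sup>2 / 2 = z\<^sup>2 / L\<^sup>2 * (1 / \<kappa>) * (1 / (2 * \<kappa>))"
      by (simp add: h_def power2_eq_square)
    also have "\<dots> \<le> z\<^sup>2 / L\<^sup>2 * (1 / \<kappa>) * 1"
      using \<kappa> by (intro mult_left_mono) auto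
    finally show ?thesis using e2 by linarith
  qed
  moreover have "(z ^ 3 + 2 * z\<^sup>2) / L\<^sup>2 * (1 / \<kappa>)
      = z ^ 3 / L\<^sup>2 * (1 / \<kappa>) + z\<^sup>2 / L\<^sup>2 * (1 / \<kappa>) + z\<^sup>2 / L\<^sup>2 * (1 / \<kappa>)"
    by (simp add: add_divide_distrib distrib_right)
  ultimately show ?thesis
    unfolding \<kappa>_def[symmetric] h_def[symmetric] by linarith
qed

text \<open>Two replacements: first the exact average over the step by the Gaussian one, then the
  resulting exponent by that of time k. The condition \<open>z \<le> L\<close> makes the exponents
  nonpositive and b small.\<close>

lemma walk_step_pointwise:
  fixes k :: nat and \<sigma> L z r :: real
  assumes z: "0 \<le> z" and r: "0 \<le> r" and k: "1 \<le> k" and L: "1 \<le> L" "z \<le> L" and \<sigma>: "\<bar>\<sigma>\<bar> \<le> 1"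
  defines "a \<equiv> riccati z r"
  defines "b \<equiv> a * (real k * \<sigma>) / ((real k + 1) * L)"
  defines "P \<equiv> log_weight z r - a * ((real k * \<sigma>)\<^sup>2 + 1) / (2 * (real k + 1) * L)"
  shows "\<bar>exp (- (z\<^sup>2 / 2 / L\<^sup>2 * \<sigma>\<^sup>2)) * exp P * (cosh b - \<sigma> / 2 * sinh b)
      - exp (log_weight z (r + 1 / (real k * L)) - riccati z (r + 1 / (real k * L)) * (real k * \<sigma>)\<^sup>2 / (2 * real k * L))\<bar>
    \<le> 7 * z\<^sup>2 / L\<^sup>2 * \<sigma> ^ 4
      + ((z ^ 3 + 2 * z\<^sup>2) / L\<^sup>2 * (1 / real k) + z / (2 * L) * (1 / real k - 1 / (real k + 1)))"
proof -
  have L0: "0 < L" using L by simp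
  have a: "0 \<le> a" "a \<le> z" using riccati_bounds[OF z r] by (auto simp: a_def)
  define D where "D = - (z\<^sup>2 / 2 / L\<^sup>2 * \<sigma>\<^sup>2)"
  define w where "w = b\<^sup>2 / 2 - \<sigma> / 2 * b"
  define Q where "Q = log_weight z (r + 1 / (real k * L))
    - riccati z (r + 1 / (real k * L)) * (real k * \<sigma>)\<^sup>2 / (2 * real k * L)"
  have \<sigma>2: "\<sigma>\<^sup>2 \<le> 1" using \<sigma> by (simp add: abs_square_le_1)
  have D0: "D \<le> 0" by (simp add: D_def)
  have P0: "P \<le> 0"
  proof -
    have "0 \<le> a * ((real k * \<sigma>)\<^sup>2 + 1) / (2 * (real k + 1) * L)" using a L0 by simp
    then show ?thesis unfolding P_def using log_weight_nonpos[of z r] by linarith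
  qed
  have r': "0 \<le> r + 1 / (real k * L)" using r L0 by simp
  have Q0: "Q \<le> 0"
  proof -
    have "0 \<le> riccati z (r + 1 / (real k * L)) * (real k * \<sigma>)\<^sup>2 / (2 * real k * L)"
      using riccati_bounds(1)[OF z r'] L0 by simp
    then show ?thesis unfolding Q_def using log_weight_nonpos[of z "r + 1 / (real k * L)"] by linarith
  qed
  \<comment> \<open>Since u \<le> 1, the gain b^2 / 2 from the Gaussian average is at most the
    quadratic term already subtracted in \<open>P\<close>, which keeps \<open>P + w\<close>
    nonpositive.\<close>
  define u where "u = a / ((real k + 1) * L)"
  have u: "0 \<le> u" "u \<le> 1"
  proof -
    show "0 \<le> u" using a L0 by (simp add: u_def)
    have "a \<le> 1 * L" using a L by simp
    also have "\<dots> \<le> (real k + 1) * L" using L0 by (intro mult_right_mono) auto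
    finally show "u \<le> 1" using L0 by (simp add: u_def)
  qed
  have bu: "b = u * (real k * \<sigma>)" by (simp add: b_def u_def)
  have PD: "P + w \<le> 0"
  proof -
    have "a * ((real k * \<sigma>)\<^sup>2 + 1) / (2 * (real k + 1) * L) = u / 2 * ((real k * \<sigma>)\<^sup>2 + 1)"
      by (simp add: u_def)
    moreover have "b\<^sup>2 / 2 \<le> u / 2 * (real k * \<sigma>)\<^sup>2"
    proof -
      have "u * u \<le> u * 1" using u by (intro mult_left_mono) auto
      then have "u\<^sup>2 * (real k * \<sigma>)\<^sup>2 \<le> u * (real k * \<sigma>)\<^sup>2"
        by (intro mult_right_mono) (auto simp: power2_eq_square)
      then show ?thesis unfolding bu by (simp add: power_mult_distrib)
    qed
    moreover have "u / 2 * ((real k * \<sigma>)\<^sup>2 + 1) \<ge> u / 2 * (real k * \<sigma>)\<^sup>2"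
      using u by (intro mult_left_mono) auto
    moreover have "0 \<le> \<sigma> / 2 * b"
    proof -
      have "\<sigma> / 2 * b = u * real k * \<sigma>\<^sup>2 / 2" by (simp add: bu power2_eq_square)
      then show ?thesis using u by simp
    qed
    ultimately show ?thesis unfolding P_def w_def using log_weight_nonpos[of z r] by linarith
  qed
  have "\<bar>b\<bar> \<le> (z / L) * \<bar>\<sigma>\<bar>"
  proof -
    have "\<bar>b\<bar> = a / L * (real k / (real k + 1)) * \<bar>\<sigma>\<bar>"
      using a L0 by (simp add: b_def abs_mult mult_ac)
    also have "\<dots> \<le> z / L * 1 * \<bar>\<sigma>\<bar>"
      using a L0 z by (intro mult_mono divide_right_mono) auto
    finally show ?thesis by simp
  qed
  then have ap: "\<bar>cosh b - \<sigma> / 2 * sinh b - exp w\<bar> \<le> 7 * (z / L)\<^sup>2 * \<bar>\<sigma>\<bar> ^ 4"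
    unfolding w_def using z L L0 \<sigma> by (intro cosh_sinh_exp_approx) auto
  have "exp D * exp P * (cosh b - \<sigma> / 2 * sinh b) - exp Q
      = exp (D + P) * (cosh b - \<sigma> / 2 * sinh b - exp w) + (exp (D + P + w) - exp Q)"
    by (simp add: exp_add algebra_simps)
  also have "\<bar>\<dots>\<bar> \<le> exp (D + P) * \<bar>cosh b - \<sigma> / 2 * sinh b - exp w\<bar> + \<bar>exp (D + P + w) - exp Q\<bar>"
    by (intro order_trans[OF abs_triangle_ineq]) (simp add: abs_mult)
  also have "\<dots> \<le> 1 * (7 * (z / L)\<^sup>2 * \<bar>\<sigma>\<bar> ^ 4) + \<bar>(D + P + w) - Q\<bar>"
  proof (rule add_mono)
    show "exp (D + P) * \<bar>cosh b - \<sigma> / 2 * sinh b - exp w\<bar> \<le> 1 * (7 * (z / L)\<^sup>2 * \<bar>\<sigma>\<bar> ^ 4)"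
      using ap D0 P0 by (intro mult_mono) auto
    have "D + P + w \<le> 0" using D0 PD by linarith
    then show "\<bar>exp (D + P + w) - exp Q\<bar> \<le> \<bar>(D + P + w) - Q\<bar>"
      using Q0 by (rule abs_exp_diff_le)
  qed
  also have "\<bar>(D + P + w) - Q\<bar> \<le> (z ^ 3 + 2 * z\<^sup>2) / L\<^sup>2 * (1 / real k) + z / (2 * L) * (1 / real k - 1 / (real k + 1))"
    using walk_step_exponent[OF z r k L(1) \<sigma>2]
    unfolding D_def P_def w_def Q_def a_def b_def by simp
  finally show ?thesis
    by (simp add: D_def Q_def power_divide power_even_abs)
qed

lemma abs_cosh_sinh_le:
  fixes b :: real
  assumes "\<bar>b\<bar> \<le> 1"
  shows "\<bar>cosh b\<bar> \<le> 3" "\<bar>sinh b\<bar> \<le> 3"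
proof -
  have "b\<^sup>2 \<le> 1" using assms by (simp add: abs_square_le_1)
  moreover have "b ^ 4 \<le> 1" using power_mono[OF assms, of 4] by (simp add: power_even_abs)
  ultimately have "cosh b \<le> 3"
    using abs_le_D1[OF abs_cosh_taylor[OF assms]] by linarith
  then show "\<bar>cosh b\<bar> \<le> 3" by simp
  have "\<bar>b\<bar> ^ 3 \<le> 1" using power_mono[OF assms, of 3] by simp
  then show "\<bar>sinh b\<bar> \<le> 3" using abs_sinh_taylor[OF assms] assms by linarith
qed

context elephant_random_walk
begin

text \<open>A crude induction using only |S(n)| \<le> n for the second moment. The constant 9 closes
  it: at order n^2 the recursion produces 2 * 9 + 6 = 24, below the 3 * 9 = 27 available in 9 (n +
  1)^3.\<close>

lemma fourth_moment_le:
  assumes p: "p = 3 / 4" and n: "n \<ge> 1"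
  shows "expectation (\<lambda>\<omega>. erw_position X n \<omega> ^ 4) \<le> 9 * real n ^ 3"
  using n
proof (induction n rule: dec_induct)
  case base
  have "expectation (\<lambda>\<omega>. erw_position X 1 \<omega> ^ 4) \<le> expectation (\<lambda>\<omega>. 1)"
    using AE_position_powers_le[of 1 4] integrable_position_powers[of 1 4]
    by (intro integral_mono_AE) (auto elim!: eventually_mono)
  then show ?case by (simp add: prob_space)
next
  case (step n)
  let ?S = "erw_position X n"
  have n: "n \<ge> 1" "real n \<ge> 1" using step by auto
  note int = integrable_position_powers[of n 4] integrable_position_powers[of n 2]
    integrable_times_next_step[OF integrable_position_powers[of n 3], of n]
    integrable_times_next_step[OF integrable_position_powers[of n 1], of n]
  have X4: "(s + x) ^ 4 = s ^ 4 + 4 * (s ^ 3 * x) + 6 * s ^ 2 + 4 * (s ^ 1 * x) + 1" if "x = 1 \<or> x = -1" for s x :: real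
    using that by (auto simp: eval_nat_numeral algebra_simps)
  have "expectation (\<lambda>\<omega>. erw_position X (Suc n) \<omega> ^ 4)
      = expectation (\<lambda>\<omega>. ?S \<omega> ^ 4 + 4 * (?S \<omega> ^ 3 * X (Suc n) \<omega>) + 6 * ?S \<omega> ^ 2 + 4 * (?S \<omega> ^ 1 * X (Suc n) \<omega>) + 1)"
  proof (rule integral_cong_AE)
    show "AE \<omega> in M. erw_position X (Suc n) \<omega> ^ 4 = ?S \<omega> ^ 4 + 4 * (?S \<omega> ^ 3 * X (Suc n) \<omega>)
        + 6 * ?S \<omega> ^ 2 + 4 * (?S \<omega> ^ 1 * X (Suc n) \<omega>) + 1"
      using AE_X_values[of "Suc n", simplified] by eventually_elim (simp only: position_Suc X4)
  qed measurable
  also have "\<dots> = expectation (\<lambda>\<omega>. ?S \<omega> ^ 4) + 4 * expectation (\<lambda>\<omega>. ?S \<omega> ^ 3 * X (Suc n) \<omega>)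
      + 6 * expectation (\<lambda>\<omega>. ?S \<omega> ^ 2) + 4 * expectation (\<lambda>\<omega>. ?S \<omega> ^ 1 * X (Suc n) \<omega>) + 1"
    using int by (simp add: prob_space del: power_one_right)
  also have "\<dots> = (1 + 2 / real n) * expectation (\<lambda>\<omega>. ?S \<omega> ^ 4) + (6 + 2 / real n) * expectation (\<lambda>\<omega>. ?S \<omega> ^ 2) + 1"
    unfolding expectation_position_power_next[OF n(1)] p by (simp add: eval_nat_numeral algebra_simps)
  also have "\<dots> \<le> (1 + 2 / real n) * (9 * real n ^ 3) + (6 + 2 / real n) * real n ^ 2 + 1"
  proof -
    have "expectation (\<lambda>\<omega>. ?S \<omega> ^ 2) \<le> expectation (\<lambda>\<omega>. real n ^ 2)"
      using AE_position_powers_le[of n 2] int by (intro integral_mono_AE) (auto elim!: eventually_mono)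
    then have "expectation (\<lambda>\<omega>. ?S \<omega> ^ 2) \<le> real n ^ 2" by (simp add: prob_space)
    then show ?thesis using step.IH by (intro add_mono mult_left_mono) auto
  qed
  also have "\<dots> = 9 * real n ^ 3 + 24 * (real n)\<^sup>2 + 2 * real n + 1"
    using n by (simp add: field_simps eval_nat_numeral)
  also have "\<dots> \<le> 9 * (real n + 1) ^ 3"
    using n by (simp add: eval_nat_numeral algebra_simps)
  finally show ?case by (simp add: add.commute)
qed

text \<open>The counterpart for the walk of the telescoping for Gaussian increments, with total time
  \<open>harm (n - 1) / L\<close> instead of 1 and with L left free until the limit is
  taken.\<close>

lemma walk_laplace_bound:
  fixes n :: nat and z L :: real
  assumes p: "p = 3 / 4" and n: "n \<ge> 1" and z: "0 \<le> z" and L: "1 \<le> L" "z \<le> L"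
  shows "\<bar>expectation (\<lambda>\<omega>. exp (- (z\<^sup>2 / 2 / L\<^sup>2 * (\<Sum>j=1..<n. (erw_position X j \<omega> / real j)\<^sup>2))))
      - exp (log_weight z (harm (n - 1) / L))\<bar>
    \<le> (z ^ 3 + 65 * z\<^sup>2) / L\<^sup>2 * harm (n - 1) + z / L"
proof -
  have L0: "0 < L" using L by simp
  define \<sigma> where "\<sigma> k \<omega> = erw_position X k \<omega> / real k" for k \<omega>
  have \<sigma>S: "real k * \<sigma> k \<omega> = erw_position X k \<omega>" if "k \<ge> 1" for k \<omega>
    using that by (simp add: \<sigma>_def)
  define c where "c = z\<^sup>2 / 2 / L\<^sup>2"
  have c: "0 \<le> c" by (simp add: c_def)
  define U where "U k \<omega> = exp (- (c * (\<Sum>j=1..<k. (\<sigma> j \<omega>)\<^sup>2)))" for k \<omega>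
  have U: "0 \<le> U k \<omega>" "U k \<omega> \<le> 1" for k \<omega>
    using c by (auto simp: U_def intro!: mult_nonneg_nonneg sum_nonneg)
  \<comment> \<open>remaining time at step k: the increments of S k / sqrt k have variance of order 1 / k\<close>
  define r where "r k = (harm (n - 1) - harm (k - 1)) / L" for k
  have r0: "0 \<le> r k" if "k \<le> n" for k
    using L0 harm_mono[of "k - 1" "n - 1", where 'a = real] that by (simp add: r_def)
  define \<Phi> where "\<Phi> k \<omega> = U k \<omega> * exp (log_weight z (r k) - riccati z (r k) * (real k * \<sigma> k \<omega>)\<^sup>2 / (2 * real k * L))" for k \<omega>
  have \<sigma>_past: "\<sigma> j \<in> borel_measurable (past k)" if "j \<le> k" for j k
    unfolding \<sigma>_def using that by (intro borel_measurable_divide measurable_position_past) auto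
  have [measurable]: "\<sigma> j \<in> borel_measurable M" for j unfolding \<sigma>_def by measurable
  \<comment> \<open>The sum in \<open>U (Suc k)\<close> stops at j = k, so it is known before step k
    + 1 is taken.\<close>
  have U_past: "U (Suc k) \<in> borel_measurable (past k)" for k
    unfolding U_def
    by (intro measurable_compose[OF _ borel_measurable_exp] borel_measurable_uminus borel_measurable_times
        borel_measurable_sum borel_measurable_power \<sigma>_past borel_measurable_const) auto
  have [measurable]: "U k \<in> borel_measurable M" for k unfolding U_def by measurable
  have [measurable]: "\<Phi> k \<in> borel_measurable M" for k unfolding \<Phi>_def by measurable
  have \<Phi>_int: "integrable M (\<Phi> k)" if "k \<le> n" for k
  proof (rule integrable_const_bound[of _ 1])
    have "log_weight z (r k) - riccati z (r k) * (real k * \<sigma> k \<omega>)\<^sup>2 / (2 * real k * L) \<le> 0" for \<omega>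
    proof -
      have "0 \<le> riccati z (r k) * (real k * \<sigma> k \<omega>)\<^sup>2 / (2 * real k * L)"
        using riccati_bounds(1)[OF z r0[OF that]] L0 by simp
      then show ?thesis using log_weight_nonpos[of z "r k"] by linarith
    qed
    then show "AE \<omega> in M. norm (\<Phi> k \<omega>) \<le> 1"
      using U by (auto simp: \<Phi>_def abs_mult intro!: mult_le_one)
  qed simp
  have \<sigma>_le: "AE \<omega> in M. \<bar>\<sigma> k \<omega>\<bar> \<le> 1" for k
    using AE_abs_position_le[of k]
    by eventually_elim (auto simp: \<sigma>_def abs_mult divide_le_eq_1)
  have step: "\<bar>expectation (\<Phi> (Suc k)) - expectation (\<Phi> k)\<bar>
      \<le> (z ^ 3 + 65 * z\<^sup>2) / L\<^sup>2 * (1 / real k) + z / (2 * L) * (1 / real k - 1 / (real k + 1))"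
    if k: "1 \<le> k" "Suc k \<le> n" for k
  proof -
    define a where "a = riccati z (r (Suc k))"
    have a: "0 \<le> a" "a \<le> z" using riccati_bounds[OF z r0[OF k(2)]] by (auto simp: a_def)
    have k0: "0 < real k" using k by simp
    define b where "b \<omega> = a * (real k * \<sigma> k \<omega>) / ((real k + 1) * L)" for \<omega>
    define P where "P \<omega> = log_weight z (r (Suc k)) - a * ((real k * \<sigma> k \<omega>)\<^sup>2 + 1) / (2 * (real k + 1) * L)" for \<omega>
    define G where "G \<omega> = U (Suc k) \<omega> * exp (P \<omega>)" for \<omega>
    have rk: "r k = r (Suc k) + 1 / (real k * L)"
    proof -
      obtain m where m: "k = Suc m" using k by (cases k) auto
      show ?thesis unfolding m r_def by (simp add: harm_Suc inverse_eq_divide diff_divide_distrib add_divide_distrib)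
    qed
    have P0: "P \<omega> \<le> 0" for \<omega>
    proof -
      have "0 \<le> a * ((real k * \<sigma> k \<omega>)\<^sup>2 + 1) / (2 * (real k + 1) * L)" using a L0 by simp
      then show ?thesis unfolding P_def using log_weight_nonpos[of z "r (Suc k)"] by linarith
    qed
    have G1: "\<bar>G \<omega>\<bar> \<le> 1" for \<omega>
      using U[of "Suc k" \<omega>] P0[of \<omega>] by (auto simp: G_def abs_mult intro!: mult_le_one)
    have b_past: "b \<in> borel_measurable (past k)"
      unfolding b_def using \<sigma>_past[of k k] by measurable
    have "P \<in> borel_measurable (past k)"
      unfolding P_def using \<sigma>_past[of k k] by measurable
    then have G_past: "G \<in> borel_measurable (past k)"
      unfolding G_def using U_past[of k] by measurable
    have sinh_past: "(\<lambda>\<omega>. sinh (b \<omega>)) \<in> borel_measurable (past k)"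
      unfolding sinh_field_def using b_past by measurable
    have cosh_past: "(\<lambda>\<omega>. cosh (b \<omega>)) \<in> borel_measurable (past k)"
      unfolding cosh_field_def using b_past by measurable
    note [measurable] = measurable_pastD[OF k(1) G_past] measurable_pastD[OF k(1) sinh_past]
      measurable_pastD[OF k(1) cosh_past]
    have b1: "AE \<omega> in M. \<bar>b \<omega>\<bar> \<le> 1"
      using \<sigma>_le[of k]
    proof eventually_elim
      case (elim \<omega>)
      have "\<bar>b \<omega>\<bar> = a / L * (real k / (real k + 1)) * \<bar>\<sigma> k \<omega>\<bar>"
        using a L0 by (simp add: b_def abs_mult mult_ac)
      also have "\<dots> \<le> 1 * 1 * 1"
        using a L L0 elim by (intro mult_mono) auto
      finally show ?case by simp
    qed
    have int_cosh: "integrable M (\<lambda>\<omega>. G \<omega> * cosh (b \<omega>))"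
    proof (rule integrable_const_bound[of _ "1 * 3"])
      show "AE \<omega> in M. norm (G \<omega> * cosh (b \<omega>)) \<le> 1 * 3"
        using b1
      proof eventually_elim
        case (elim \<omega>)
        then show ?case
          unfolding real_norm_def abs_mult using G1 abs_cosh_sinh_le(1)[OF elim] by (intro mult_mono) auto
      qed
    qed measurable
    have int_sinh: "integrable M (\<lambda>\<omega>. G \<omega> * sinh (b \<omega>))"
    proof (rule integrable_const_bound[of _ "1 * 3"])
      show "AE \<omega> in M. norm (G \<omega> * sinh (b \<omega>)) \<le> 1 * 3"
        using b1
      proof eventually_elim
        case (elim \<omega>)
        then show ?case
          unfolding real_norm_def abs_mult using G1 abs_cosh_sinh_le(2)[OF elim] by (intro mult_mono) auto
      qed
    qed measurable
    have int_sinh_\<sigma>: "integrable M (\<lambda>\<omega>. G \<omega> * sinh (b \<omega>) * erw_position X k \<omega>)"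
    proof -
      have "integrable M (\<lambda>\<omega>. real k * (G \<omega> * sinh (b \<omega>) * \<sigma> k \<omega>))"
      proof (intro integrable_mult_right Bochner_Integration.integrable_bound[OF int_sinh])
        show "AE \<omega> in M. norm (G \<omega> * sinh (b \<omega>) * \<sigma> k \<omega>) \<le> norm (G \<omega> * sinh (b \<omega>))"
          using \<sigma>_le[of k]
          by eventually_elim (simp only: real_norm_def abs_mult, intro mult_left_le, auto)
      qed measurable
      then show ?thesis unfolding \<sigma>S[OF k(1), symmetric] by (simp only: mult_ac)
    qed
    \<comment> \<open>On the values 1 and -1 the exponential is affine in x, so the conditional mean
      of the step determines its conditional expectation.\<close>
    have expbX: "exp (- (t * x)) = cosh t - x * sinh t" if "x = 1 \<or> x = -1" for t x :: real
      using that cosh_minus_sinh[of t] cosh_plus_sinh[of t] by auto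
    have "expectation (\<Phi> (Suc k)) = expectation (\<lambda>\<omega>. G \<omega> * cosh (b \<omega>) - G \<omega> * sinh (b \<omega>) * X (Suc k) \<omega>)"
    proof (rule integral_cong_AE)
      show "AE \<omega> in M. \<Phi> (Suc k) \<omega> = G \<omega> * cosh (b \<omega>) - G \<omega> * sinh (b \<omega>) * X (Suc k) \<omega>"
        using AE_X_values[of "Suc k", simplified]
      proof eventually_elim
        case (elim \<omega>)
        define S where "S = erw_position X k \<omega>"
        define x where "x = X (Suc k) \<omega>"
        have x: "x = 1 \<or> x = -1" using elim by (simp add: x_def)
        have "(real (Suc k) * \<sigma> (Suc k) \<omega>)\<^sup>2 = (S\<^sup>2 + 1) + 2 * (S * x)"
          using x by (subst \<sigma>S) (auto simp: position_Suc S_def x_def power2_eq_square algebra_simps)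
        then have "log_weight z (r (Suc k)) - a * (real (Suc k) * \<sigma> (Suc k) \<omega>)\<^sup>2 / (2 * real (Suc k) * L)
            = log_weight z (r (Suc k)) - a * ((S\<^sup>2 + 1) + 2 * (S * x)) / (2 * (real k + 1) * L)"
          by (simp add: add.commute)
        also have "\<dots> = P \<omega> + - (b \<omega> * x)"
        proof -
          have "a * ((S\<^sup>2 + 1) + 2 * (S * x)) / (2 * (real k + 1) * L)
              = a * (S\<^sup>2 + 1) / (2 * (real k + 1) * L) + 2 * (a * S * x) / (2 * ((real k + 1) * L))"
            by (simp only: distrib_left add_divide_distrib mult_ac)
          also have "2 * (a * S * x) / (2 * ((real k + 1) * L)) = a * S / ((real k + 1) * L) * x"
            by simp
          finally show ?thesis unfolding P_def b_def \<sigma>S[OF k(1)] S_def by simp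
        qed
        finally have "\<Phi> (Suc k) \<omega> = G \<omega> * exp (- (b \<omega> * x))"
          by (simp only: \<Phi>_def a_def[symmetric] G_def exp_add mult_ac)
        then show ?case unfolding expbX[OF x] by (simp add: x_def algebra_simps)
      qed
    qed measurable
    also have "\<dots> = expectation (\<lambda>\<omega>. G \<omega> * cosh (b \<omega>)) - expectation (\<lambda>\<omega>. G \<omega> * sinh (b \<omega>) * X (Suc k) \<omega>)"
      using int_cosh integrable_times_next_step[OF int_sinh, of k] by simp
    also have "expectation (\<lambda>\<omega>. G \<omega> * sinh (b \<omega>) * X (Suc k) \<omega>)
        = 1 / 2 / real k * expectation (\<lambda>\<omega>. G \<omega> * sinh (b \<omega>) * erw_position X k \<omega>)"
      using expectation_next_step[OF k(1) borel_measurable_times[OF G_past sinh_past] int_sinh] p by simp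
    also have "expectation (\<lambda>\<omega>. G \<omega> * cosh (b \<omega>)) - \<dots>
        = expectation (\<lambda>\<omega>. G \<omega> * cosh (b \<omega>) - 1 / 2 / real k * (G \<omega> * sinh (b \<omega>) * erw_position X k \<omega>))"
      using int_cosh int_sinh_\<sigma> by simp
    also have "(\<lambda>\<omega>. G \<omega> * cosh (b \<omega>) - 1 / 2 / real k * (G \<omega> * sinh (b \<omega>) * erw_position X k \<omega>))
        = (\<lambda>\<omega>. G \<omega> * (cosh (b \<omega>) - \<sigma> k \<omega> / 2 * sinh (b \<omega>)))"
      by (simp add: fun_eq_iff \<sigma>_def algebra_simps)
    finally have e1: "expectation (\<Phi> (Suc k)) = expectation (\<lambda>\<omega>. G \<omega> * (cosh (b \<omega>) - \<sigma> k \<omega> / 2 * sinh (b \<omega>)))" .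
    have int_G: "integrable M (\<lambda>\<omega>. G \<omega> * (cosh (b \<omega>) - \<sigma> k \<omega> / 2 * sinh (b \<omega>)))"
    proof -
      have "integrable M (\<lambda>\<omega>. G \<omega> * cosh (b \<omega>) - 1 / 2 / real k * (G \<omega> * sinh (b \<omega>) * erw_position X k \<omega>))"
        using int_cosh int_sinh_\<sigma> by simp
      then show ?thesis by (simp add: \<sigma>_def algebra_simps)
    qed
    define \<epsilon> where "\<epsilon> = (z ^ 3 + 2 * z\<^sup>2) / L\<^sup>2 * (1 / real k) + z / (2 * L) * (1 / real k - 1 / (real k + 1))"
    have bd: "AE \<omega> in M. \<bar>G \<omega> * (cosh (b \<omega>) - \<sigma> k \<omega> / 2 * sinh (b \<omega>)) - \<Phi> k \<omega>\<bar>
        \<le> 7 * z\<^sup>2 / L\<^sup>2 * \<sigma> k \<omega> ^ 4 + \<epsilon>"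
      using \<sigma>_le[of k]
    proof eventually_elim
      case (elim \<omega>)
      define W where "W = exp (- (c * (\<sigma> k \<omega>)\<^sup>2)) * exp (P \<omega>) * (cosh (b \<omega>) - \<sigma> k \<omega> / 2 * sinh (b \<omega>))
        - exp (log_weight z (r k) - riccati z (r k) * (real k * \<sigma> k \<omega>)\<^sup>2 / (2 * real k * L))"
      have "U (Suc k) \<omega> = U k \<omega> * exp (- (c * (\<sigma> k \<omega>)\<^sup>2))"
        using k(1) by (simp add: U_def exp_add[symmetric] distrib_left)
      then have "G \<omega> * (cosh (b \<omega>) - \<sigma> k \<omega> / 2 * sinh (b \<omega>)) - \<Phi> k \<omega> = U k \<omega> * W"
        unfolding G_def \<Phi>_def W_def by (simp only: right_diff_distrib mult.assoc)
      then have "\<bar>G \<omega> * (cosh (b \<omega>) - \<sigma> k \<omega> / 2 * sinh (b \<omega>)) - \<Phi> k \<omega>\<bar> = U k \<omega> * \<bar>W\<bar>"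
        using U(1)[of k \<omega>] by (simp add: abs_mult)
      also have "\<dots> \<le> 1 * \<bar>W\<bar>" using U by (intro mult_right_mono) auto
      also have "1 * \<bar>W\<bar> \<le> 7 * z\<^sup>2 / L\<^sup>2 * \<sigma> k \<omega> ^ 4 + \<epsilon>"
        using walk_step_pointwise[OF z r0[OF k(2)] k(1) L elim]
        unfolding W_def P_def b_def a_def c_def rk \<epsilon>_def by simp
      finally show ?case .
    qed
    have \<sigma>4: "integrable M (\<lambda>\<omega>. \<sigma> k \<omega> ^ 4)" "expectation (\<lambda>\<omega>. \<sigma> k \<omega> ^ 4) \<le> 9 / real k"
    proof -
      show "integrable M (\<lambda>\<omega>. \<sigma> k \<omega> ^ 4)"
        unfolding \<sigma>_def power_divide using integrable_position_powers[of k 4] by simp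
      have "expectation (\<lambda>\<omega>. \<sigma> k \<omega> ^ 4) = expectation (\<lambda>\<omega>. erw_position X k \<omega> ^ 4) / real k ^ 4"
        unfolding \<sigma>_def power_divide by simp
      also have "\<dots> \<le> 9 * real k ^ 3 / real k ^ 4"
        using fourth_moment_le[OF p k(1)] by (intro divide_right_mono) auto
      also have "\<dots> = 9 / real k" using k0 by (simp add: eval_nat_numeral)
      finally show "expectation (\<lambda>\<omega>. \<sigma> k \<omega> ^ 4) \<le> 9 / real k" .
    qed
    have "\<bar>expectation (\<Phi> (Suc k)) - expectation (\<Phi> k)\<bar>
        = \<bar>expectation (\<lambda>\<omega>. G \<omega> * (cosh (b \<omega>) - \<sigma> k \<omega> / 2 * sinh (b \<omega>)) - \<Phi> k \<omega>)\<bar>"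
      unfolding e1 using int_G \<Phi>_int[of k] k by simp
    also have "\<dots> \<le> expectation (\<lambda>\<omega>. \<bar>G \<omega> * (cosh (b \<omega>) - \<sigma> k \<omega> / 2 * sinh (b \<omega>)) - \<Phi> k \<omega>\<bar>)"
      by (rule integral_abs_bound)
    also have "\<dots> \<le> expectation (\<lambda>\<omega>. 7 * z\<^sup>2 / L\<^sup>2 * \<sigma> k \<omega> ^ 4 + \<epsilon>)"
      using int_G \<Phi>_int[of k] k \<sigma>4(1) bd by (intro integral_mono_AE) auto
    also have "\<dots> = 7 * z\<^sup>2 / L\<^sup>2 * expectation (\<lambda>\<omega>. \<sigma> k \<omega> ^ 4) + \<epsilon>"
      using \<sigma>4(1) by (simp add: prob_space)
    also have "\<dots> \<le> 7 * z\<^sup>2 / L\<^sup>2 * (9 / real k) + \<epsilon>"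
      using \<sigma>4(2) by (intro add_mono mult_left_mono) auto
    \<comment> \<open>The 65 is 7 * 9 + 2: Gaussian replacement times fourth moment, plus the
      exponent error.\<close>
    also have "\<dots> = (z ^ 3 + 65 * z\<^sup>2) / L\<^sup>2 * (1 / real k) + z / (2 * L) * (1 / real k - 1 / (real k + 1))"
    proof -
      have "7 * z\<^sup>2 / L\<^sup>2 * (9 / real k) + (z ^ 3 + 2 * z\<^sup>2) / L\<^sup>2 * (1 / real k) = (z ^ 3 + 65 * z\<^sup>2) / L\<^sup>2 * (1 / real k)"
        by (simp add: add_divide_distrib)
      then show ?thesis unfolding \<epsilon>_def by linarith
    qed
    finally show ?thesis .
  qed
  define A where "A = (z ^ 3 + 65 * z\<^sup>2) / L\<^sup>2"
  have tel: "\<bar>expectation (\<Phi> (Suc k)) - expectation (\<Phi> 1)\<bar> \<le> A * harm k + z / (2 * L) * (1 - 1 / (real k + 1))"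
    if "Suc k \<le> n" for k
    using that
  proof (induction k)
    case 0
    then show ?case by (simp add: harm_expand)
  next
    case (Suc k)
    have "A * harm (Suc k) = A * harm k + A * (1 / real (Suc k))"
      by (simp add: harm_Suc inverse_eq_divide distrib_left)
    moreover have "z / (2 * L) * (1 - 1 / (real (Suc k) + 1)) = z / (2 * L) * (1 - 1 / (real k + 1))
        + z / (2 * L) * (1 / real (Suc k) - 1 / (real (Suc k) + 1))"
      by (simp only: distrib_left[symmetric]) (simp add: add.commute)
    ultimately show ?case
      using Suc.IH Suc.prems step[of "Suc k", folded A_def] by linarith
  qed
  have "z / (2 * L) * (1 - 1 / (real (n - 1) + 1)) \<le> z / (2 * L) * 1"
    using z L0 by (intro mult_left_mono) auto
  then have 1: "\<bar>expectation (\<Phi> n) - expectation (\<Phi> 1)\<bar> \<le> A * harm (n - 1) + z / (2 * L)"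
    using tel[of "n - 1"] n by simp
  \<comment> \<open>The telescoping starts at k = 1, where the walk is not at 0 as the Brownian
    motion is; this costs the second half of z / L.\<close>
  have 2: "\<bar>expectation (\<Phi> 1) - exp (log_weight z (r 1))\<bar> \<le> z / (2 * L)"
  proof -
    have a: "0 \<le> riccati z (r 1)" "riccati z (r 1) \<le> z" using riccati_bounds[OF z r0[OF n]] by auto
    have "AE \<omega> in M. \<bar>\<Phi> 1 \<omega> - exp (log_weight z (r 1))\<bar> \<le> z / (2 * L)"
      using \<sigma>_le[of 1]
    proof eventually_elim
      case (elim \<omega>)
      define y where "y = riccati z (r 1) * (\<sigma> 1 \<omega>)\<^sup>2 / (2 * L)"
      have "(\<sigma> 1 \<omega>)\<^sup>2 \<le> 1" using elim by (simp add: abs_square_le_1)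
      then have "riccati z (r 1) * (\<sigma> 1 \<omega>)\<^sup>2 \<le> z * 1" using a z by (intro mult_mono) auto
      then have y: "0 \<le> y" "y \<le> z / (2 * L)"
        using a L0 by (auto simp: y_def intro!: divide_right_mono)
      have "\<Phi> 1 \<omega> = exp (log_weight z (r 1) - y)" by (simp add: \<Phi>_def U_def y_def)
      moreover have "\<bar>exp (log_weight z (r 1) - y) - exp (log_weight z (r 1))\<bar> \<le> \<bar>(log_weight z (r 1) - y) - log_weight z (r 1)\<bar>"
        using y log_weight_nonpos[of z "r 1"] by (intro abs_exp_diff_le) linarith+
      ultimately show ?case using y by simp
    qed
    then have "expectation (\<lambda>\<omega>. \<bar>\<Phi> 1 \<omega> - exp (log_weight z (r 1))\<bar>) \<le> expectation (\<lambda>\<omega>. z / (2 * L))"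
      using \<Phi>_int[OF n] by (intro integral_mono_AE) auto
    also have "\<dots> = z / (2 * L)" by (simp add: prob_space)
    finally have "\<bar>expectation (\<lambda>\<omega>. \<Phi> 1 \<omega> - exp (log_weight z (r 1)))\<bar> \<le> z / (2 * L)"
      by (rule order_trans[OF integral_abs_bound])
    moreover have "expectation (\<lambda>\<omega>. \<Phi> 1 \<omega> - exp (log_weight z (r 1))) = expectation (\<Phi> 1) - exp (log_weight z (r 1))"
      using \<Phi>_int[OF n] by (simp add: prob_space)
    ultimately show ?thesis by simp
  qed
  have "\<Phi> n = (\<lambda>\<omega>. exp (- (z\<^sup>2 / 2 / L\<^sup>2 * (\<Sum>j=1..<n. (erw_position X j \<omega> / real j)\<^sup>2))))"
    by (simp add: \<Phi>_def U_def c_def \<sigma>_def r_def fun_eq_iff)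
  moreover have "r 1 = harm (n - 1) / L" by (simp add: r_def harm_expand)
  moreover have "z / (2 * L) + z / (2 * L) = z / L" by simp
  ultimately show ?thesis using 1 2 unfolding A_def by (simp only: abs_le_iff) linarith
qed

section \<open>Passage to the limit at p = 3/4\<close>

text \<open>The total time of the rescaled walk tends to 1, because
  \<open>harm n - ln (real n)\<close> converges.\<close>

lemma harm_pred_over_ln: "(\<lambda>n. harm (n - 1) / ln (real n)) \<longlonglongrightarrow> (1::real)"
proof -
  have ln: "filterlim (\<lambda>n. ln (real n)) at_top sequentially"
    by (rule filterlim_compose[OF ln_at_top filterlim_real_sequentially])
  obtain g :: real where g: "(\<lambda>n. harm n - ln (real n)) \<longlonglongrightarrow> g"
    using euler_mascheroni_convergent convergent_def by blast
  have "(\<lambda>n. (harm n - ln (real n)) - 1 / real n) \<longlonglongrightarrow> g - 0"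
    by (intro tendsto_diff g lim_const_over_n)
  then have "(\<lambda>n. ((harm n - ln (real n)) - 1 / real n) / ln (real n)) \<longlonglongrightarrow> 0"
    using ln by (rule real_tendsto_divide_at_top)
  then have "(\<lambda>n. 1 + ((harm n - ln (real n)) - 1 / real n) / ln (real n)) \<longlonglongrightarrow> 1 + 0"
    by (intro tendsto_add tendsto_const)
  then have "(\<lambda>n. 1 + ((harm n - ln (real n)) - 1 / real n) / ln (real n)) \<longlonglongrightarrow> 1" by simp
  then show ?thesis
  proof (rule Lim_transform_eventually)
    show "\<forall>\<^sub>F n in sequentially. 1 + ((harm n - ln (real n)) - 1 / real n) / ln (real n) = harm (n - 1) / ln (real n)"
      using eventually_ge_at_top[of 2]
    proof eventually_elim
      case (elim n)
      then obtain m where m: "n = Suc m" by (cases n) auto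
      have "ln (real n) \<noteq> 0" using elim by simp
      then have "1 + ((harm n - ln (real n)) - 1 / real n) / ln (real n) = (harm n - 1 / real n) / ln (real n)"
        by (simp add: diff_divide_distrib)
      also have "harm n - 1 / real n = harm (n - 1)"
        unfolding m by (simp add: harm_Suc inverse_eq_divide)
      finally show ?case .
    qed
  qed
qed

lemma walk_laplace_tendsto:
  assumes p: "p = 3 / 4" and z: "0 \<le> z"
  shows "(\<lambda>n. expectation (\<lambda>\<omega>. exp (- (z\<^sup>2 / 2 / (ln (real n))\<^sup>2 * (\<Sum>j=1..<n. (erw_position X j \<omega> / real j)\<^sup>2)))))
    \<longlonglongrightarrow> 1 / sqrt (cosh z)"
    (is "?E \<longlonglongrightarrow> _")
proof -
  have ln: "filterlim (\<lambda>n. ln (real n)) at_top sequentially"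
    by (rule filterlim_compose[OF ln_at_top filterlim_real_sequentially])
  have 1: "(\<lambda>n. exp (log_weight z (harm (n - 1) / ln (real n)))) \<longlonglongrightarrow> exp (log_weight z 1)"
    using DERIV_isCont[OF has_derivative_log_weight]
    by (intro tendsto_exp isCont_tendsto_compose[OF _ harm_pred_over_ln])
  have 2: "(\<lambda>n. ?E n - exp (log_weight z (harm (n - 1) / ln (real n)))) \<longlonglongrightarrow> 0"
  proof (rule Lim_null_comparison)
    show "\<forall>\<^sub>F n in sequentially. norm (?E n - exp (log_weight z (harm (n - 1) / ln (real n))))
        \<le> (z ^ 3 + 65 * z\<^sup>2) / (ln (real n))\<^sup>2 * harm (n - 1) + z / ln (real n)"
      \<comment> \<open>The bound is applied with L = ln n, which eventually exceeds both 1 and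
        z.\<close>
      using eventually_ge_at_top[of 1] filterlim_at_top[THEN iffD1, OF ln, rule_format, of 1]
        filterlim_at_top[THEN iffD1, OF ln, rule_format, of z]
      by eventually_elim (use walk_laplace_bound[OF p _ z] in simp)
    have "(\<lambda>n. (z ^ 3 + 65 * z\<^sup>2) * (harm (n - 1) / ln (real n)) / ln (real n) + z / ln (real n)) \<longlonglongrightarrow> 0 + 0"
      by (rule tendsto_add[OF
          real_tendsto_divide_at_top[OF tendsto_mult[OF tendsto_const harm_pred_over_ln] ln]
          real_tendsto_divide_at_top[OF tendsto_const ln]])
    then show "(\<lambda>n. (z ^ 3 + 65 * z\<^sup>2) / (ln (real n))\<^sup>2 * harm (n - 1) + z / ln (real n)) \<longlonglongrightarrow> 0"
      by (simp add: power2_eq_square)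
  qed
  from tendsto_add[OF 2 1] show ?thesis by (simp add: exp_log_weight)
qed

end

theorem theorem3p14:
  fixes M :: "'a measure" and p q :: real
    and X :: "nat \<Rightarrow> 'a \<Rightarrow> real" and K :: "nat \<Rightarrow> 'a \<Rightarrow> nat" and R :: "nat \<Rightarrow> 'a \<Rightarrow> bool"
  assumes "elephant_random_walk M p q X K R"
  shows "(p = 3 / 4 \<longrightarrow>
           (\<forall>(N :: 'b measure) B. standard_brownian_motion N B \<longrightarrow>
             weak_conv_m (\<lambda>n. distr M borel (\<lambda>\<omega>. erw_V X n \<omega> / (ln (real n))\<^sup>2))
                         (distr N borel (\<lambda>\<omega>. 4 * integral_of_square B \<omega>)))) \<and>
         (p < 3 / 4 \<longrightarrow>
           (AE \<omega> in M. (\<lambda>n. erw_V X n \<omega> / (ln (real n))\<^sup>2) \<longlonglongrightarrow> 0))"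
proof -
  interpret elephant_random_walk M p q X K R by fact
  have "weak_conv_m (\<lambda>n. distr M borel (\<lambda>\<omega>. erw_V X n \<omega> / (ln (real n))\<^sup>2))
      (distr N borel (\<lambda>\<omega>. 4 * integral_of_square B \<omega>))"
    if p: "p = 3 / 4" and B: "standard_brownian_motion N B" for N :: "'b measure" and B
  proof (rule weak_conv_m_if_Laplace_transforms)
    interpret B: standard_brownian_motion N B by (rule B)
    show "prob_space M" by (rule prob_space_axioms)
    show "prob_space N" by (rule B.prob_space_axioms)
    show "(\<lambda>\<omega>. erw_V X n \<omega> / (ln (real n))\<^sup>2) \<in> borel_measurable M" for n by measurable
    show "(\<lambda>\<omega>. 4 * integral_of_square B \<omega>) \<in> borel_measurable N" by measurable
    show "0 \<le> erw_V X n \<omega> / (ln (real n))\<^sup>2" for n \<omega> by (simp add: V_nonneg)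
    show "0 \<le> 4 * integral_of_square B \<omega>" for \<omega> by (simp add: B.integral_of_square_nonneg)
    fix m :: nat
    \<comment> \<open>Chosen so that z^2 / 2 = 4 m, the 4 being the factor in both V(n) and the
      limit.\<close>
    define z where "z = sqrt (8 * real m)"
    have z: "0 \<le> z" "z\<^sup>2 = 8 * real m" by (auto simp: z_def)
    have "(\<lambda>n. expectation (\<lambda>\<omega>. exp (- (real m * (erw_V X n \<omega> / (ln (real n))\<^sup>2))))) \<longlonglongrightarrow> 1 / sqrt (cosh z)"
      using walk_laplace_tendsto[OF p z(1)] by (simp add: z(2) erw_V_def mult_ac)
    moreover have "B.expectation (\<lambda>\<omega>. exp (- (real m * (4 * integral_of_square B \<omega>)))) = 1 / sqrt (cosh z)"
      using B.laplace_integral_of_square[OF z(1)] by (simp add: z(2) mult_ac)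
    ultimately show "(\<lambda>n. expectation (\<lambda>\<omega>. exp (- (real m * (erw_V X n \<omega> / (ln (real n))\<^sup>2))))) \<longlonglongrightarrow>
        B.expectation (\<lambda>\<omega>. exp (- (real m * (4 * integral_of_square B \<omega>))))"
      by simp
  qed
  then show ?thesis using AE_V_tendsto_0 by blast
qed

end
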